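(* Let $\mathfrak{g}$ be a symmetrizable Kac-Moody Lie algebra over $\mathbb{C}$ and let $A$ be a commutative associative unital $\mathbb{C}$-algebra. For all $a,b\in A$, the operator $$\Omega(a,b)=2\nu^{-1}(\rho)(ab)+\sum_i u^i(a)u_i(b)+\Omega_{a,b}+\Omega_{b,a},\qquad \Omega_{a,b}=\sum_{\alpha\in\Delta^+}\sum_j e^j_{-\alpha}(a)\,e^j_{\alpha}(b),$$ is a central operator on the modules in the category $\mathcal{O}$; that is, for every $\mathfrak{g}\otimes A$-module $V$ in $\mathcal{O}$, the linear operator $\Omega(a,b)$ on $V$ commutes with the action of $\mathfrak{g}=\mathfrak{g}\otimes 1$ on $V$.
   Context: All vector spaces and tensor products are over $\mathbb{C}$. $\mathfrak{g}$ is a symmetrizable Kac-Moody Lie algebra with Cartan subalgebra $\mathfrak{h}$, simple roots $\alpha_1,\dots,\alpha_l$, simple coroots $\alpha_1^\vee,\dots,\alpha_l^\vee$, set of roots $\Delta$, positive roots $\Delta^+$, root space decomposition $\mathfrak{g}=\mathfrak{h}\oplus\bigoplus_{\alpha\in\Delta}\mathfrak{g}_\alpha$, and a fixed non-degenerate invariant symmetric bilinear form $(\cdot,\cdot)$. For $\alpha=\sum n_i\alpha_i\in\Delta^+$ put $\mathrm{ht}\,\alpha=\sum n_i$. The Lie algebra $\mathfrak{g}(A)=\mathfrak{g}\otimes A$ has bracket $[x\otimes a,y\otimes b]=[x,y]\otimes ab$; write $x(a)=x\otimes a$, and identify $\mathfrak{g}$ with $\mathfrak{g}\otimes 1$. The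 form restricted to $\mathfrak{h}$ is non-degenerate and induces an isomorphism $\nu:\mathfrak{h}\to\mathfrak{h}^*$, $\nu(h)(h_1)=(h,h_1)$, and hence a form, also denoted $(\cdot,\cdot)$, on $\mathfrak{h}^*$. Fix $\rho\in\mathfrak{h}^*$ with $(\rho,\alpha_i)=\frac12(\alpha_i,\alpha_i)$ for $1\le i\le l$. For each $\alpha\in\Delta^+$ let $\{e^j_\alpha\}_j$ be a basis of $\mathfrak{g}_\alpha$ and $\{e^j_{-\alpha}\}_j$ the dual basis of $\mathfrak{g}_{-\alpha}$ with respect to $(\cdot,\cdot)$. Let $\{u_i\}$ be a basis of $\mathfrak{h}$ and $\{u^i\}$ the dual basis of $\mathfrak{h}$ with respect to $(\cdot,\cdot)$. A $\mathfrak{g}(A)$-module $V$ is in the category $\mathcal{O}$ if (a) $V$ is a weight module with respect to $\mathfrak{h}$ (i.e. with respect to $\mathfrak{h}\otimes 1$) with finite dimensional weight spaces; and (b) for every $v\in V$ and $a\in A$ one has $(X_\alpha\otimes a)v=0$ for all $\alpha\in\Delta^+$ with $\mathrm{ht}\,\alpha\gg0$ and all $X_\alpha\in\mathfrak{g}_\alpha$. On such a $V$ the (possibly infinite) sum $\Omega(a,b)$ is locally finite: for each $v\in V$ only finitely many terms of $\Omega(a,b)v$ are non-zero, so $\Omega(a,b)$ is a well-defined linear operator on $V$. *)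

theory Defs
  imports "HOL-Analysis.Analysis" "HOL-Library.Poly_Mapping"
begin

section \<open>Complex vector spaces, Lie algebras and commutative algebras\<close>

class complex_vector = ab_group_add +
  fixes scaleC :: "complex \<Rightarrow> 'a \<Rightarrow> 'a" (infixr "*\<^sub>C" 75)
  assumes scaleC_add_right: "c *\<^sub>C (x + y) = c *\<^sub>C x + c *\<^sub>C y"
    and scaleC_add_left: "(c + d) *\<^sub>C x = c *\<^sub>C x + d *\<^sub>C x"
    and scaleC_scaleC: "c *\<^sub>C d *\<^sub>C x = (c * d) *\<^sub>C x"
    and scaleC_one: "1 *\<^sub>C x = x"

global_interpretation complex_vector: vector_space "scaleC :: complex \<Rightarrow> 'a \<Rightarrow> 'a :: complex_vector"
  defines cdependent = complex_vector.dependent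
    and crepresentation = complex_vector.representation
    and csubspace = complex_vector.subspace
    and cspan = complex_vector.span
    and cextend_basis = complex_vector.extend_basis
    and cdim = complex_vector.dim
  by unfold_locales (auto simp: scaleC_add_right scaleC_add_left scaleC_scaleC scaleC_one)

abbreviation clinear :: "('a::complex_vector \<Rightarrow> 'b::complex_vector) \<Rightarrow> bool" where
  "clinear \<equiv> Vector_Spaces.linear scaleC scaleC"

class complex_lie_algebra = complex_vector +
  fixes bracket :: "'a \<Rightarrow> 'a \<Rightarrow> 'a"
  assumes bracket_add_left: "bracket (x + y) z = bracket x z + bracket y z"
    and bracket_add_right: "bracket x (y + z) = bracket x y + bracket x z"
    and bracket_scaleC_left: "bracket (c *\<^sub>C x) y = c *\<^sub>C bracket x y"
    and bracket_scaleC_right: "bracket x (c *\<^sub>C y) = c *\<^sub>C bracket x y"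
    and bracket_self: "bracket x x = 0"
    and bracket_jacobi:
      "bracket x (bracket y z) + bracket y (bracket z x) + bracket z (bracket x y) = 0"

text \<open>The sort \<open>{comm_ring, comm_monoid_mult}\<close> is that of commutative unital rings without the
  axiom \<open>0 \<noteq> 1\<close> of \<^class>\<open>comm_ring_1\<close>, so that the zero algebra is included.\<close>

class complex_comm_algebra = complex_vector + comm_ring + comm_monoid_mult +
  assumes scaleC_mult_left: "(c *\<^sub>C a) * b = c *\<^sub>C (a * b)"


section \<open>The tensor product of complex vector spaces\<close>

text \<open>The tensor product is the free vector space on pairs modulo the bilinearity relations.\<close>

instantiation poly_mapping :: (type, complex_vector) complex_vector
begin

lift_definition scaleC_poly_mapping :: "complex \<Rightarrow> ('a \<Rightarrow>\<^sub>0 'b) \<Rightarrow> ('a \<Rightarrow>\<^sub>0 'b)"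
  is "\<lambda>c p k. c *\<^sub>C p k"
  by (erule finite_subset[rotated]) auto

instance
  by standard (transfer, simp add: fun_eq_iff scaleC_add_right scaleC_add_left scaleC_scaleC scaleC_one)+

end

instantiation complex :: complex_vector
begin

definition scaleC_complex :: "complex \<Rightarrow> complex \<Rightarrow> complex" where
  "scaleC_complex c x = c * x"

instance
  by standard (auto simp: scaleC_complex_def algebra_simps)

end

abbreviation pure :: "'a \<Rightarrow> 'b \<Rightarrow> ('a \<times> 'b) \<Rightarrow>\<^sub>0 complex" where
  "pure x a \<equiv> Poly_Mapping.single (x, a) 1"

definition bilinearity_relators ::
    "(('a::complex_vector \<times> 'b::complex_vector) \<Rightarrow>\<^sub>0 complex) set" where
  "bilinearity_relators =
     {pure (x + y) a - pure x a - pure y a | x y a. True} \<union>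
     {pure x (a + b) - pure x a - pure x b | x a b. True} \<union>
     {pure (c *\<^sub>C x) a - c *\<^sub>C pure x a | c x a. True} \<union>
     {pure x (c *\<^sub>C a) - c *\<^sub>C pure x a | c x a. True}"

definition tensor_equiv ::
    "(('a::complex_vector \<times> 'b::complex_vector) \<Rightarrow>\<^sub>0 complex) \<Rightarrow>
     (('a \<times> 'b) \<Rightarrow>\<^sub>0 complex) \<Rightarrow> bool" where
  "tensor_equiv p q \<longleftrightarrow> p - q \<in> cspan bilinearity_relators"

lemma equivp_tensor_equiv: "equivp tensor_equiv"
proof (rule equivpI)
  show "reflp tensor_equiv"
    by (auto simp: reflp_def tensor_equiv_def complex_vector.span_zero)
  show "symp tensor_equiv"
    unfolding symp_def tensor_equiv_def
    by (metis complex_vector.span_neg minus_diff_eq)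
  show "transp tensor_equiv"
    unfolding transp_def tensor_equiv_def
    using complex_vector.span_add by fastforce
qed

quotient_type (overloaded) ('a, 'b) tensor =
  "('a::complex_vector \<times> 'b::complex_vector) \<Rightarrow>\<^sub>0 complex" / tensor_equiv
  by (rule equivp_tensor_equiv)

instantiation tensor :: (complex_vector, complex_vector) complex_vector
begin

lift_definition zero_tensor :: "('a, 'b) tensor" is 0 .

lift_definition plus_tensor :: "('a, 'b) tensor \<Rightarrow> ('a, 'b) tensor \<Rightarrow> ('a, 'b) tensor" is "(+)"
  unfolding tensor_equiv_def add_diff_add by (rule complex_vector.span_add)

lift_definition minus_tensor :: "('a, 'b) tensor \<Rightarrow> ('a, 'b) tensor \<Rightarrow> ('a, 'b) tensor" is "(-)"
proof -
  fix p p' q q' :: "('a \<times> 'b) \<Rightarrow>\<^sub>0 complex"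
  assume "tensor_equiv p p'" "tensor_equiv q q'"
  then have "(p - p') - (q - q') \<in> cspan bilinearity_relators"
    unfolding tensor_equiv_def by (rule complex_vector.span_diff)
  then show "tensor_equiv (p - q) (p' - q')"
    unfolding tensor_equiv_def by (simp add: algebra_simps)
qed

lift_definition uminus_tensor :: "('a, 'b) tensor \<Rightarrow> ('a, 'b) tensor" is uminus
proof -
  fix p p' :: "('a \<times> 'b) \<Rightarrow>\<^sub>0 complex"
  assume "tensor_equiv p p'"
  then have "- (p - p') \<in> cspan bilinearity_relators"
    unfolding tensor_equiv_def by (rule complex_vector.span_neg)
  then show "tensor_equiv (- p) (- p')"
    unfolding tensor_equiv_def by simp
qed

lift_definition scaleC_tensor :: "complex \<Rightarrow> ('a, 'b) tensor \<Rightarrow> ('a, 'b) tensor" is scaleC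
  unfolding tensor_equiv_def complex_vector.scale_right_diff_distrib[symmetric]
  by (rule complex_vector.span_scale)

instance
proof
  fix x y z :: "('a, 'b) tensor" and c d :: complex
  note R = equivp_reflp[OF equivp_tensor_equiv]
  show "x + y + z = x + (y + z)" by transfer (simp add: R add.assoc)
  show "x + y = y + x" by transfer (simp add: R add.commute)
  show "0 + x = x" by transfer (simp add: R)
  show "- x + x = 0" by transfer (simp add: R)
  show "x - y = x + - y" by transfer (simp add: R)
  show "c *\<^sub>C (x + y) = c *\<^sub>C x + c *\<^sub>C y" by transfer (simp add: R scaleC_add_right)
  show "(c + d) *\<^sub>C x = c *\<^sub>C x + d *\<^sub>C x" by transfer (simp add: R scaleC_add_left)
  show "c *\<^sub>C d *\<^sub>C x = (c * d) *\<^sub>C x" by transfer (simp add: R scaleC_scaleC)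
  show "1 *\<^sub>C x = x" by transfer (simp add: R scaleC_one)
qed

end

lift_definition tensor :: "'a::complex_vector \<Rightarrow> 'b::complex_vector \<Rightarrow> ('a, 'b) tensor"
    (infixl "\<otimes>" 76) is pure .

lemma tensor_relations:
  shows tensor_add_left: "(x + y) \<otimes> a = x \<otimes> a + y \<otimes> a"
    and tensor_add_right: "x \<otimes> (a + b) = x \<otimes> a + x \<otimes> b"
    and tensor_scaleC_left: "(c *\<^sub>C x) \<otimes> a = c *\<^sub>C (x \<otimes> a)"
    and tensor_scaleC_right: "x \<otimes> (c *\<^sub>C a) = c *\<^sub>C (x \<otimes> a)"
  by (transfer, simp only: tensor_equiv_def flip: diff_diff_eq,
      rule complex_vector.span_base, force simp: bilinearity_relators_def)+

lemma poly_mapping_eq_sum_single: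
  "p = (\<Sum>k\<in>Poly_Mapping.keys p. Poly_Mapping.lookup p k *\<^sub>C Poly_Mapping.single k (1::complex))"
  by (rule poly_mapping_eqI)
    (auto simp: lookup_sum scaleC_poly_mapping.rep_eq scaleC_complex_def lookup_single when_def
       in_keys_iff if_distrib[of "\<lambda>x. _ * x"] sum.delta cong: if_cong)

lemma tensor_induct [case_names zero tensor add]:
  assumes "P 0" and "\<And>c x a. P (c *\<^sub>C (x \<otimes> a))" and "\<And>s t. P s \<Longrightarrow> P t \<Longrightarrow> P (s + t)"
  shows "P (t :: ('a::complex_vector, 'b::complex_vector) tensor)"
proof -
  obtain p where p: "t = abs_tensor p"
    by (metis Quotient3_abs_rep[OF Quotient3_tensor])
  have "P (abs_tensor (\<Sum>k\<in>K. f k *\<^sub>C Poly_Mapping.single k (1::complex)))" if "finite K"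
    for K and f :: "'a \<times> 'b \<Rightarrow> complex"
    using that
  proof (induction K rule: finite_induct)
    case empty
    then show ?case using assms(1) by (simp add: zero_tensor.abs_eq)
  next
    case (insert k K)
    obtain x a where "k = (x, a)" by fastforce
    then have "abs_tensor (f k *\<^sub>C Poly_Mapping.single k (1::complex)) = f k *\<^sub>C (x \<otimes> a)"
      by (simp add: scaleC_tensor.abs_eq tensor.abs_eq)
    then show ?case using insert assms(2,3)
      by (simp flip: plus_tensor.abs_eq)
  qed
  from this[of "Poly_Mapping.keys p" "Poly_Mapping.lookup p"] show ?thesis
    using p poly_mapping_eq_sum_single[of p] by simp
qed


section \<open>The Lie algebra \<open>\<gg> \<otimes> A\<close>\<close>

definition free_ext :: "('k \<Rightarrow> 'c::complex_vector) \<Rightarrow> ('k \<Rightarrow>\<^sub>0 complex) \<Rightarrow> 'c" where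
  "free_ext f p = (\<Sum>k\<in>Poly_Mapping.keys p. Poly_Mapping.lookup p k *\<^sub>C f k)"

lemma free_ext_superset:
  assumes "finite S" "Poly_Mapping.keys p \<subseteq> S"
  shows "free_ext f p = (\<Sum>k\<in>S. Poly_Mapping.lookup p k *\<^sub>C f k)"
  unfolding free_ext_def
  by (rule sum.mono_neutral_left) (use assms in \<open>auto simp: in_keys_iff\<close>)

lemma free_ext_add: "free_ext f (p + q) = free_ext f p + free_ext f q"
proof -
  let ?S = "Poly_Mapping.keys p \<union> Poly_Mapping.keys q"
  have "free_ext f (p + q) = (\<Sum>k\<in>?S. Poly_Mapping.lookup (p + q) k *\<^sub>C f k)"
    by (rule free_ext_superset) (auto simp: keys_add)
  also have "\<dots> = (\<Sum>k\<in>?S. Poly_Mapping.lookup p k *\<^sub>C f k) +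
      (\<Sum>k\<in>?S. Poly_Mapping.lookup q k *\<^sub>C f k)"
    by (simp add: lookup_add scaleC_add_left sum.distrib)
  finally show ?thesis
    by (simp add: free_ext_superset[of ?S])
qed

lemma free_ext_scaleC: "free_ext f (c *\<^sub>C p) = c *\<^sub>C free_ext f p"
proof -
  have "free_ext f (c *\<^sub>C p) =
      (\<Sum>k\<in>Poly_Mapping.keys p. Poly_Mapping.lookup (c *\<^sub>C p) k *\<^sub>C f k)"
    by (rule free_ext_superset)
      (auto simp: in_keys_iff scaleC_poly_mapping.rep_eq scaleC_complex_def)
  then show ?thesis
    by (simp add: free_ext_def scaleC_poly_mapping.rep_eq scaleC_complex_def scaleC_scaleC
        complex_vector.scale_sum_right)
qed

lemma free_ext_diff: "free_ext f (p - q) = free_ext f p - free_ext f q"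
  using free_ext_add[of f "p - q" q] by simp

lemma free_ext_single [simp]: "free_ext f (Poly_Mapping.single k 1) = f k"
  by (simp add: free_ext_def scaleC_one)

lemma free_ext_span:
  assumes "\<And>r. r \<in> R \<Longrightarrow> free_ext f r \<in> cspan T" and "p \<in> cspan R"
  shows "free_ext f p \<in> cspan T"
  using assms(2)
proof (induction rule: complex_vector.span_induct_alt)
  case base
  then show ?case by (simp add: free_ext_def complex_vector.span_zero)
next
  case (step c x y)
  then show ?case
    by (simp add: free_ext_add free_ext_scaleC assms(1) complex_vector.span_add
        complex_vector.span_scale)
qed

definition free_bracket ::
    "(('g::complex_lie_algebra \<times> 'a::complex_comm_algebra) \<Rightarrow>\<^sub>0 complex) \<Rightarrow>
     (('g \<times> 'a) \<Rightarrow>\<^sub>0 complex) \<Rightarrow> (('g \<times> 'a) \<Rightarrow>\<^sub>0 complex)" where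
  "free_bracket p q =
     free_ext (\<lambda>(x, a). free_ext (\<lambda>(y, b). pure (bracket x y) (a * b)) q) p"

lemma free_bracket_swap:
  "free_bracket p q =
     free_ext (\<lambda>(y, b). free_ext (\<lambda>(x, a). pure (bracket x y) (a * b)) p) q"
  unfolding free_bracket_def free_ext_def
  by (simp add: case_prod_unfold complex_vector.scale_sum_right scaleC_scaleC)
    (subst sum.swap, simp add: mult.commute)

lemma scaleC_mult_right: "(a::'a::complex_comm_algebra) * (c *\<^sub>C b) = c *\<^sub>C (a * b)"
  by (metis scaleC_mult_left mult.commute)

lemma free_bracket_left:
  assumes "p \<in> cspan bilinearity_relators"
  shows "free_bracket p q \<in> cspan bilinearity_relators"
  unfolding free_bracket_swap
proof (rule free_ext_span[where R = UNIV])
  show "q \<in> cspan UNIV" by simp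
next
  have *: "free_ext (\<lambda>(x, a). pure (bracket x y) (a * b)) p \<in> cspan bilinearity_relators"
    for y b
  proof (rule free_ext_span[OF _ assms])
    fix r :: "('a \<times> 'b) \<Rightarrow>\<^sub>0 complex"
    assume "r \<in> bilinearity_relators"
    then have "free_ext (\<lambda>(x, a). pure (bracket x y) (a * b)) r \<in> bilinearity_relators"
      unfolding bilinearity_relators_def
      by (elim UnE; clarsimp simp: free_ext_diff free_ext_scaleC bracket_add_left
          bracket_scaleC_left distrib_right scaleC_mult_left) blast+
    then show "free_ext (\<lambda>(x, a). pure (bracket x y) (a * b)) r \<in> cspan bilinearity_relators"
      by (rule complex_vector.span_base)
  qed
  fix r :: "('a \<times> 'b) \<Rightarrow>\<^sub>0 complex"
  show "free_ext (\<lambda>(y, b). free_ext (\<lambda>(x, a). pure (bracket x y) (a * b)) p) r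
      \<in> cspan bilinearity_relators"
    unfolding free_ext_def[of _ r]
    by (intro complex_vector.span_sum complex_vector.span_scale) (use * in auto)
qed

lemma free_bracket_right:
  assumes "q \<in> cspan bilinearity_relators"
  shows "free_bracket p q \<in> cspan bilinearity_relators"
proof -
  have *: "free_ext (\<lambda>(y, b). pure (bracket x y) (a * b)) q \<in> cspan bilinearity_relators"
    for x a
  proof (rule free_ext_span[OF _ assms])
    fix r :: "('a \<times> 'b) \<Rightarrow>\<^sub>0 complex"
    assume "r \<in> bilinearity_relators"
    then have "free_ext (\<lambda>(y, b). pure (bracket x y) (a * b)) r \<in> bilinearity_relators"
      unfolding bilinearity_relators_def
      by (elim UnE; clarsimp simp: free_ext_diff free_ext_scaleC bracket_add_right
          bracket_scaleC_right distrib_left scaleC_mult_right) blast+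
    then show "free_ext (\<lambda>(y, b). pure (bracket x y) (a * b)) r \<in> cspan bilinearity_relators"
      by (rule complex_vector.span_base)
  qed
  show ?thesis
    unfolding free_bracket_def free_ext_def[of _ p]
    by (intro complex_vector.span_sum complex_vector.span_scale) (use * in auto)
qed

lemma free_bracket_diff:
  "free_bracket (p - p') q = free_bracket p q - free_bracket p' q"
  "free_bracket p (q - q') = free_bracket p q - free_bracket p q'"
  by (simp add: free_bracket_def free_ext_diff, simp add: free_bracket_swap free_ext_diff)

lemma free_bracket_add:
  "free_bracket (p + p') q = free_bracket p q + free_bracket p' q"
  "free_bracket p (q + q') = free_bracket p q + free_bracket p q'"
  by (simp add: free_bracket_def free_ext_add, simp add: free_bracket_swap free_ext_add)

lemma free_bracket_scaleC:
  "free_bracket (c *\<^sub>C p) q = c *\<^sub>C free_bracket p q"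
  "free_bracket p (c *\<^sub>C q) = c *\<^sub>C free_bracket p q"
  by (simp add: free_bracket_def free_ext_scaleC, simp add: free_bracket_swap free_ext_scaleC)

lift_definition tensor_bracket ::
    "('g::complex_lie_algebra, 'a::complex_comm_algebra) tensor \<Rightarrow> ('g, 'a) tensor \<Rightarrow>
     ('g, 'a) tensor" is free_bracket
proof -
  fix p p' q q' :: "('g \<times> 'a) \<Rightarrow>\<^sub>0 complex"
  assume "tensor_equiv p p'" "tensor_equiv q q'"
  then have "free_bracket (p - p') q + free_bracket p' (q - q') \<in> cspan bilinearity_relators"
    unfolding tensor_equiv_def
    by (intro complex_vector.span_add free_bracket_left free_bracket_right)
  then show "tensor_equiv (free_bracket p q) (free_bracket p' q')"
    unfolding tensor_equiv_def by (simp add: free_bracket_diff)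
qed

lemma tensor_bracket_tensor:
  "tensor_bracket (x \<otimes> a) (y \<otimes> b) = bracket x y \<otimes> (a * b)"
  by transfer (simp add: free_bracket_def equivp_reflp[OF equivp_tensor_equiv])

instantiation tensor :: (complex_lie_algebra, complex_comm_algebra) complex_lie_algebra
begin

definition bracket_tensor :: "('a, 'b) tensor \<Rightarrow> ('a, 'b) tensor \<Rightarrow> ('a, 'b) tensor" where
  "bracket_tensor = tensor_bracket"

instance
proof
  fix x y z :: "('a, 'b) tensor" and c :: complex
  note R = equivp_reflp[OF equivp_tensor_equiv]
  have al: "bracket (x + y) z = bracket x z + bracket y z" for x y z :: "('a, 'b) tensor"
    unfolding bracket_tensor_def by transfer (simp add: R free_bracket_add)
  have ar: "bracket x (y + z) = bracket x y + bracket x z" for x y z :: "('a, 'b) tensor"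
    unfolding bracket_tensor_def by transfer (simp add: R free_bracket_add)
  have sl: "bracket (c *\<^sub>C x) y = c *\<^sub>C bracket x y" for c and x y :: "('a, 'b) tensor"
    unfolding bracket_tensor_def by transfer (simp add: R free_bracket_scaleC)
  have sr: "bracket x (c *\<^sub>C y) = c *\<^sub>C bracket x y" for c and x y :: "('a, 'b) tensor"
    unfolding bracket_tensor_def by transfer (simp add: R free_bracket_scaleC)
  have zl: "bracket 0 y = 0" for y :: "('a, 'b) tensor"
    using sl[of 0 0 y] by simp
  have zr: "bracket y 0 = 0" for y :: "('a, 'b) tensor"
    using sr[of y 0 0] by simp
  have tt: "bracket (u \<otimes> a) (v \<otimes> b) = bracket u v \<otimes> (a * b)" for u v :: 'a and a b :: 'b
    by (simp add: bracket_tensor_def tensor_bracket_tensor)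
  have antig: "bracket u v = - bracket v u" for u v :: 'a
  proof -
    have "bracket u v + bracket v u = 0"
      using bracket_self[of "u + v"] unfolding bracket_add_left bracket_add_right
      by (simp add: bracket_self add.commute)
    then show ?thesis by (simp only: eq_neg_iff_add_eq_0)
  qed
  have tz: "(0::'a) \<otimes> a = 0" for a :: 'b
    using tensor_scaleC_left[of 0 0 a] by simp
  have tn: "(- u) \<otimes> a = - (u \<otimes> a)" for u :: 'a and a :: 'b
    using tensor_add_left[of u "- u" a] by (simp add: tz eq_neg_iff_add_eq_0 add.commute)
  have anti: "bracket x y = - bracket y x" for x y :: "('a, 'b) tensor"
  proof (induction x rule: tensor_induct)
    case (tensor c u a)
    show ?case
    proof (induction y rule: tensor_induct)
      case (tensor d v b)
      show ?case
        by (simp add: sl sr tt antig[of u v] tn mult.commute scaleC_scaleC)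
    qed (simp_all add: al ar zl zr)
  qed (simp_all add: al ar zl zr)
  show "bracket (x + y) z = bracket x z + bracket y z" by (rule al)
  show "bracket x (y + z) = bracket x y + bracket x z" by (rule ar)
  show "bracket (c *\<^sub>C x) y = c *\<^sub>C bracket x y" by (rule sl)
  show "bracket x (c *\<^sub>C y) = c *\<^sub>C bracket x y" by (rule sr)
  show "bracket x x = 0"
  proof -
    have "bracket x x + bracket x x = 0" using anti[of x x] by (metis add.left_inverse)
    then have "2 *\<^sub>C bracket x x = 0"
      by (metis scaleC_add_left scaleC_one one_add_one)
    then show ?thesis by simp
  qed
  have sum3: "(s1 + t1) + (s2 + t2) + (s3 + t3) = 0" if "s1 + s2 + s3 = 0" "t1 + t2 + t3 = 0"
    for s1 s2 s3 t1 t2 t3 :: "('a, 'b) tensor"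
  proof -
    have "(s1 + t1) + (s2 + t2) + (s3 + t3) = (s1 + s2 + s3) + (t1 + t2 + t3)"
      by (simp only: ac_simps)
    then show ?thesis by (simp add: that)
  qed
  show "bracket x (bracket y z) + bracket y (bracket z x) + bracket z (bracket x y) = 0"
  proof (induction x rule: tensor_induct)
    case (tensor c u a)
    show ?case
    proof (induction y rule: tensor_induct)
      case (tensor d v b)
      show ?case
      proof (induction z rule: tensor_induct)
        case (tensor k w e)
        have "bracket u (bracket v w) \<otimes> (a * b * e) + bracket v (bracket w u) \<otimes> (a * b * e)
            + bracket w (bracket u v) \<otimes> (a * b * e) = 0"
          by (simp add: bracket_jacobi tz flip: tensor_add_left)
        then have "(c * d * k) *\<^sub>C (bracket u (bracket v w) \<otimes> (a * b * e)
            + bracket v (bracket w u) \<otimes> (a * b * e) + bracket w (bracket u v) \<otimes> (a * b * e)) = 0"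
          by simp
        then show ?case
          by (simp add: sl sr tt scaleC_scaleC mult_ac scaleC_add_right)
      qed (auto simp: al ar zl zr intro: sum3)
    qed (auto simp: al ar zl zr intro: sum3)
  qed (auto simp: al ar zl zr intro: sum3)
qed

end

lemma bracket_tensor: "bracket (x \<otimes> a) (y \<otimes> b) = bracket x y \<otimes> (a * b)"
  by (simp add: bracket_tensor_def tensor_bracket_tensor)


section \<open>Symmetrizable Kac-Moody algebras\<close>

definition generalized_cartan_matrix :: "int^'i^'i \<Rightarrow> bool" where
  "generalized_cartan_matrix C \<longleftrightarrow>
     (\<forall>i. C $ i $ i = 2) \<and>
     (\<forall>i j. i \<noteq> j \<longrightarrow> C $ i $ j \<le> 0) \<and>
     (\<forall>i j. C $ i $ j = 0 \<longrightarrow> C $ j $ i = 0)"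

definition complex_matrix :: "int^'i^'i \<Rightarrow> complex^'i^'i" where
  "complex_matrix C = (\<chi> i j. of_int (C $ i $ j))"

definition symmetrizable :: "int^'i^'i \<Rightarrow> bool" where
  "symmetrizable C \<longleftrightarrow>
     (\<exists>D B. (\<forall>i j. i \<noteq> j \<longrightarrow> D $ i $ j = 0) \<and> invertible D \<and> transpose B = B \<and>
            complex_matrix C = D ** B)"

text \<open>An element of the dual of a subspace \<open>H\<close> is represented by the function on the ambient
  space that extends it by 0 outside of \<open>H\<close>. In this way functionals that agree on \<open>H\<close> are
  equal, and the representatives are closed under pointwise linear combinations.\<close>

definition dual_space :: "'g::complex_vector set \<Rightarrow> ('g \<Rightarrow> complex) set" where
  "dual_space H = {\<phi>. (\<forall>x\<in>H. \<forall>y\<in>H. \<phi> (x + y) = \<phi> x + \<phi> y) \<and>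
                      (\<forall>c. \<forall>x\<in>H. \<phi> (c *\<^sub>C x) = c * \<phi> x) \<and>
                      (\<forall>x. x \<notin> H \<longrightarrow> \<phi> x = 0)}"

definition lie_subalgebra :: "'g::complex_lie_algebra set \<Rightarrow> bool" where
  "lie_subalgebra S \<longleftrightarrow> csubspace S \<and> (\<forall>x\<in>S. \<forall>y\<in>S. bracket x y \<in> S)"

definition lie_ideal :: "'g::complex_lie_algebra set \<Rightarrow> bool" where
  "lie_ideal I \<longleftrightarrow> csubspace I \<and> (\<forall>x. \<forall>y\<in>I. bracket x y \<in> I)"

text \<open>The Lie algebra \<open>'g\<close> is the Kac-Moody algebra of the generalized Cartan matrix \<open>C\<close>, with
  Chevalley generators \<open>E i\<close>, \<open>F i\<close> (Kac, Infinite dimensional Lie algebras, Chapter 1).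
  Kac defines it as the quotient of the Lie algebra on generators \<open>H\<close>, \<open>E i\<close>, \<open>F i\<close>
  with the relations \<open>bracket_E_F\<close> to \<open>bracket_H_F\<close> by the largest ideal that meets \<open>H\<close>
  trivially. That \<open>'g\<close> is such a quotient means that the relations hold in \<open>'g\<close>, that \<open>H\<close>
  and the \<open>E i\<close>, \<open>F i\<close> generate \<open>'g\<close>, and that no non-zero ideal of \<open>'g\<close> meets \<open>H\<close>
  trivially.
  The assumptions \<open>subspace_H\<close> to \<open>dim_H\<close> say that \<open>(H, \<alpha>, \<alpha>c)\<close> is a (minimal)
  realization of \<open>C\<close>; \<open>dim_H\<close> also makes \<open>H\<close> finite-dimensional, as \<^const>\<open>cdim\<close> is 0
  on infinite-dimensional spaces and the rank of \<open>C\<close> is at most its size.\<close>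

locale kac_moody_algebra =
  fixes C :: "int^'i^'i"
    and H :: "'g::complex_lie_algebra set"
    and \<alpha> :: "'i \<Rightarrow> 'g \<Rightarrow> complex"
    and \<alpha>c :: "'i \<Rightarrow> 'g"
    and E F :: "'i \<Rightarrow> 'g"
  assumes gcm: "generalized_cartan_matrix C"
    and subspace_H: "csubspace H"
    and simple_root: "\<alpha> i \<in> dual_space H"
    and simple_coroot: "\<alpha>c i \<in> H"
    and independent_roots: "(\<forall>h. (\<Sum>i\<in>UNIV. c i * \<alpha> i h) = 0) \<Longrightarrow> c i = 0"
    and independent_coroots: "(\<Sum>i\<in>UNIV. c i *\<^sub>C \<alpha>c i) = 0 \<Longrightarrow> c i = 0"
    and root_coroot: "\<alpha> j (\<alpha>c i) = of_int (C $ i $ j)"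
    and dim_H: "cdim H + rank (complex_matrix C) = 2 * CARD('i)"
    and bracket_E_F: "bracket (E i) (F j) = (if i = j then \<alpha>c i else 0)"
    and bracket_H_H: "h \<in> H \<Longrightarrow> h' \<in> H \<Longrightarrow> bracket h h' = 0"
    and bracket_H_E: "h \<in> H \<Longrightarrow> bracket h (E i) = \<alpha> i h *\<^sub>C E i"
    and bracket_H_F: "h \<in> H \<Longrightarrow> bracket h (F i) = - (\<alpha> i h *\<^sub>C F i)"
    and generated: "lie_subalgebra S \<Longrightarrow> H \<union> range E \<union> range F \<subseteq> S \<Longrightarrow> S = UNIV"
    and no_ideal: "lie_ideal I \<Longrightarrow> I \<inter> H = {0} \<Longrightarrow> I = {0}"

definition root_space ::
    "'g::complex_lie_algebra set \<Rightarrow> ('g \<Rightarrow> complex) \<Rightarrow> 'g set" where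
  "root_space H \<beta> = {x. \<forall>h\<in>H. bracket h x = \<beta> h *\<^sub>C x}"

definition roots :: "'g::complex_lie_algebra set \<Rightarrow> ('g \<Rightarrow> complex) set" where
  "roots H = {\<beta> \<in> dual_space H. \<beta> \<noteq> (\<lambda>h. 0) \<and> root_space H \<beta> \<noteq> {0}}"

definition root_comb :: "('i::finite \<Rightarrow> 'g \<Rightarrow> complex) \<Rightarrow> ('i \<Rightarrow> nat) \<Rightarrow> 'g \<Rightarrow> complex" where
  "root_comb \<alpha> n = (\<lambda>h. \<Sum>i\<in>UNIV. of_nat (n i) * \<alpha> i h)"

definition positive_roots ::
    "'g::complex_lie_algebra set \<Rightarrow> ('i::finite \<Rightarrow> 'g \<Rightarrow> complex) \<Rightarrow> ('g \<Rightarrow> complex) set" where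
  "positive_roots H \<alpha> = {\<beta> \<in> roots H. \<exists>n. \<beta> = root_comb \<alpha> n}"

definition height :: "('i::finite \<Rightarrow> 'g \<Rightarrow> complex) \<Rightarrow> ('g \<Rightarrow> complex) \<Rightarrow> nat" where
  "height \<alpha> \<beta> = (THE k. \<exists>n. \<beta> = root_comb \<alpha> n \<and> k = (\<Sum>i\<in>UNIV. n i))"


section \<open>Invariant forms and dual bases\<close>

locale invariant_form =
  fixes form :: "'g::complex_lie_algebra \<Rightarrow> 'g \<Rightarrow> complex"
  assumes linear_left: "clinear (\<lambda>x. form x y)"
    and linear_right: "clinear (\<lambda>y. form x y)"
    and symmetric: "form x y = form y x"
    and invariant: "form (bracket x y) z = form x (bracket y z)"
    and nondegenerate: "(\<And>y. form x y = 0) \<Longrightarrow> x = 0"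

definition nu ::
    "'g::complex_lie_algebra set \<Rightarrow> ('g \<Rightarrow> 'g \<Rightarrow> complex) \<Rightarrow> 'g \<Rightarrow> 'g \<Rightarrow> complex" where
  "nu H form h = (\<lambda>h'. if h' \<in> H then form h h' else 0)"

definition nu_inv ::
    "'g::complex_lie_algebra set \<Rightarrow> ('g \<Rightarrow> 'g \<Rightarrow> complex) \<Rightarrow> ('g \<Rightarrow> complex) \<Rightarrow> 'g" where
  "nu_inv H form = inv_into H (nu H form)"

definition dual_form ::
    "'g::complex_lie_algebra set \<Rightarrow> ('g \<Rightarrow> 'g \<Rightarrow> complex) \<Rightarrow>
     ('g \<Rightarrow> complex) \<Rightarrow> ('g \<Rightarrow> complex) \<Rightarrow> complex" where
  "dual_form H form \<phi> \<psi> = form (nu_inv H form \<phi>) (nu_inv H form \<psi>)"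

definition is_basis :: "nat set \<Rightarrow> (nat \<Rightarrow> 'g::complex_vector) \<Rightarrow> 'g set \<Rightarrow> bool" where
  "is_basis J b S \<longleftrightarrow> inj_on b J \<and> \<not> cdependent (b ` J) \<and> cspan (b ` J) = S"

definition dual_bases ::
    "('g::complex_vector \<Rightarrow> 'g \<Rightarrow> complex) \<Rightarrow> nat set \<Rightarrow> (nat \<Rightarrow> 'g) \<Rightarrow> 'g set \<Rightarrow>
     (nat \<Rightarrow> 'g) \<Rightarrow> 'g set \<Rightarrow> bool" where
  "dual_bases form J b S b' S' \<longleftrightarrow>
     is_basis J b S \<and> is_basis J b' S' \<and>
     (\<forall>j\<in>J. \<forall>k\<in>J. form (b j) (b' k) = (if j = k then 1 else 0))"


section \<open>The category O and the operator Omega\<close>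

locale lie_module =
  fixes act :: "'l::complex_lie_algebra \<Rightarrow> 'v::complex_vector \<Rightarrow> 'v"
  assumes linear_act: "clinear (act x)"
    and linear_act_left: "clinear (\<lambda>x. act x v)"
    and act_bracket: "act (bracket x y) v = act x (act y v) - act y (act x v)"

definition weight_space ::
    "'g::complex_lie_algebra set \<Rightarrow>
     (('g, 'a::complex_comm_algebra) tensor \<Rightarrow> 'v::complex_vector \<Rightarrow> 'v) \<Rightarrow>
     ('g \<Rightarrow> complex) \<Rightarrow> 'v set" where
  "weight_space H act \<mu> = {v. \<forall>h\<in>H. act (h \<otimes> 1) v = \<mu> h *\<^sub>C v}"

text \<open>A sum of weight spaces of different weights is always direct, so \<open>sum_weight_spaces\<close>
  makes \<open>'v\<close> the direct sum of the weight spaces.\<close>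

locale category_O = lie_module act
  for act :: "('g::complex_lie_algebra, 'a::complex_comm_algebra) tensor \<Rightarrow>
      'v::complex_vector \<Rightarrow> 'v" +
  fixes H :: "'g set" and \<alpha> :: "'i::finite \<Rightarrow> 'g \<Rightarrow> complex"
  assumes sum_weight_spaces: "cspan (\<Union>\<mu>\<in>dual_space H. weight_space H act \<mu>) = UNIV"
    and finite_weight_spaces:
      "\<mu> \<in> dual_space H \<Longrightarrow> \<exists>B. finite B \<and> cspan B = weight_space H act \<mu>"
    and high_roots_vanish:
      "\<exists>N. \<forall>\<beta>\<in>positive_roots H \<alpha>. N \<le> height \<alpha> \<beta> \<longrightarrow> (\<forall>x\<in>root_space H \<beta>. act (x \<otimes> a) v = 0)"

definition root_index ::
    "'g::complex_lie_algebra set \<Rightarrow> ('i::finite \<Rightarrow> 'g \<Rightarrow> complex) \<Rightarrow> (('g \<Rightarrow> complex) \<times> nat) set"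
  where
  "root_index H \<alpha> = (SIGMA \<beta>:positive_roots H \<alpha>. {..<cdim (root_space H \<beta>)})"

text \<open>In the following \<open>ep \<beta> j\<close> and \<open>em \<beta> j\<close> stand for the basis vectors
  \<open>e\<^sup>j\<^bsub>\<beta>\<^esub>\<close> and \<open>e\<^sup>j\<^bsub>-\<beta>\<^esub>\<close>, and \<open>u i\<close> and \<open>u' i\<close> for \<open>u\<^sub>i\<close> and \<open>u\<^sup>i\<close>.
  \<^const>\<open>supp_sum\<close> adds up the non-zero terms of a sum, which are finitely many for modules in
  the category O.\<close>

definition Omega_term ::
    "(('g::complex_lie_algebra, 'a::complex_comm_algebra) tensor \<Rightarrow> 'v::complex_vector \<Rightarrow> 'v) \<Rightarrow>
     (('g \<Rightarrow> complex) \<Rightarrow> nat \<Rightarrow> 'g) \<Rightarrow> (('g \<Rightarrow> complex) \<Rightarrow> nat \<Rightarrow> 'g) \<Rightarrow>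
     'a \<Rightarrow> 'a \<Rightarrow> 'v \<Rightarrow> ('g \<Rightarrow> complex) \<times> nat \<Rightarrow> 'v" where
  "Omega_term act ep em a b v = (\<lambda>(\<beta>, j). act (em \<beta> j \<otimes> a) (act (ep \<beta> j \<otimes> b) v))"

definition Omega_half ::
    "'g::complex_lie_algebra set \<Rightarrow> ('i::finite \<Rightarrow> 'g \<Rightarrow> complex) \<Rightarrow>
     (('g, 'a::complex_comm_algebra) tensor \<Rightarrow> 'v::complex_vector \<Rightarrow> 'v) \<Rightarrow>
     (('g \<Rightarrow> complex) \<Rightarrow> nat \<Rightarrow> 'g) \<Rightarrow> (('g \<Rightarrow> complex) \<Rightarrow> nat \<Rightarrow> 'g) \<Rightarrow>
     'a \<Rightarrow> 'a \<Rightarrow> 'v \<Rightarrow> 'v" where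
  "Omega_half H \<alpha> act ep em a b v = supp_sum (Omega_term act ep em a b v) (root_index H \<alpha>)"

definition Omega ::
    "'g::complex_lie_algebra set \<Rightarrow> ('i::finite \<Rightarrow> 'g \<Rightarrow> complex) \<Rightarrow>
     ('g \<Rightarrow> 'g \<Rightarrow> complex) \<Rightarrow> ('g \<Rightarrow> complex) \<Rightarrow>
     (nat \<Rightarrow> 'g) \<Rightarrow> (nat \<Rightarrow> 'g) \<Rightarrow>
     (('g \<Rightarrow> complex) \<Rightarrow> nat \<Rightarrow> 'g) \<Rightarrow> (('g \<Rightarrow> complex) \<Rightarrow> nat \<Rightarrow> 'g) \<Rightarrow>
     (('g, 'a::complex_comm_algebra) tensor \<Rightarrow> 'v::complex_vector \<Rightarrow> 'v) \<Rightarrow>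
     'a \<Rightarrow> 'a \<Rightarrow> 'v \<Rightarrow> 'v" where
  "Omega H \<alpha> form \<rho> u u' ep em act a b v =
     act ((2 *\<^sub>C nu_inv H form \<rho>) \<otimes> (a * b)) v +
     (\<Sum>i<cdim H. act (u' i \<otimes> a) (act (u i \<otimes> b) v)) +
     Omega_half H \<alpha> act ep em a b v + Omega_half H \<alpha> act ep em b a v"

end

theory Submission
  imports Defs
begin

text \<open>
  The elements \<open>x\<close> of the Lie algebra for which \<open>x \<otimes> 1\<close> commutes with \<open>\<Omega>(a, b)\<close> form a
  subalgebra, so it is enough to treat \<open>H\<close> and the Chevalley generators. For these the
  commutator is computed summand by summand. Write \<open>t\<close> for the element of \<open>H\<close> that represents
  \<open>\<alpha>\<^sub>i\<close> with respect to the form, and take \<open>z = E\<^sub>i\<close>.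

  In \<open>\<Omega>\<^bsub>a,b\<^esub> = \<Sum>\<^bsub>\<beta>\<^esub> \<Sum>\<^bsub>j\<^esub> e\<^bsub>-\<beta>\<^esub>\<^sup>j(a) e\<^bsub>\<beta>\<^esub>\<^sup>j(b)\<close> the bracket with \<open>z\<close> either raises the second
  factor from weight \<open>\<beta>\<close> to \<open>\<beta> + \<alpha>\<^sub>i\<close>, or raises the first factor from weight \<open>-\<beta>\<close> to \<open>-(\<beta> -
  \<alpha>\<^sub>i)\<close>. Expansion in dual bases and invariance of the form show that the first contribution of
  \<open>\<beta>\<close> is the negative of the second one of \<open>\<beta> + \<alpha>\<^sub>i\<close> (\<open>bracket_cancel\<close>). So the sum telescopes
  along \<open>\<alpha>\<^sub>i\<close>-strings (\<open>sum_shift_cancel\<close>). What survives is the second contribution of \<open>\<beta> =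
  \<alpha>\<^sub>i\<close>, where the difference of the weights is 0 and no longer a root. There \<open>[E\<^sub>i, y] = (E\<^sub>i,
  y) t\<close> for \<open>y\<close> of weight \<open>-\<alpha>\<^sub>i\<close> (\<open>bracket_opposite_roots\<close>), so the commutator of \<open>E\<^sub>i\<close> with
  \<open>\<Omega>\<^bsub>a,b\<^esub>\<close> is \<open>t(a) E\<^sub>i(b)\<close>. The Cartan summand contributes \<open>- E\<^sub>i(a) t(b) - t(a) E\<^sub>i(b)\<close>, which
  together with \<open>t(a) E\<^sub>i(b) + t(b) E\<^sub>i(a)\<close> leaves \<open>[t(b), E\<^sub>i(a)] = (\<alpha>\<^sub>i, \<alpha>\<^sub>i) E\<^sub>i(ab)\<close>. This
  cancels the contribution \<open>- 2 (\<rho>, \<alpha>\<^sub>i) E\<^sub>i(ab)\<close> of the \<open>\<rho>\<close>-summand by the choice of \<open>\<rho>\<close>. The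
  computation for \<open>F\<^sub>i\<close> runs along the same strings downwards.

  The telescoping needs that \<open>\<beta> \<plusminus> \<alpha>\<^sub>i\<close>, for a positive root \<open>\<beta>\<close>, is a positive root, or 0, or
  has root space 0, and that the zero weight space is \<open>H\<close>. Both follow from the triangular
  decomposition: the span of \<open>H\<close>, the iterated brackets of the \<open>E\<^sub>i\<close> and those of the \<open>F\<^sub>i\<close> is
  stable under brackets with all generators, hence everything (\<open>triangular_decomposition\<close>), and
  weight vectors of distinct weights are independent.
\<close>

section \<open>Linear maps and brackets\<close>

lemma clinearI:
  assumes "\<And>x y. f (x + y) = f x + f y" and "\<And>c x. f (c *\<^sub>C x) = c *\<^sub>C f x"
  shows "clinear f"
  unfolding linear_iff_module_hom
  by (simp add: module_hom_def module_hom_axioms_def assms complex_vector.module_axioms)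

lemmas clinear_simps =
  module_hom.add[OF module_hom_linearI] module_hom.scale[OF module_hom_linearI]
  module_hom.zero[OF module_hom_linearI] module_hom.neg[OF module_hom_linearI]
  module_hom.diff[OF module_hom_linearI] module_hom.sum[OF module_hom_linearI]

lemma clinear_add: "clinear f \<Longrightarrow> clinear g \<Longrightarrow> clinear (\<lambda>x. f x + g x)"
  by (rule clinearI) (simp_all add: clinear_simps scaleC_add_right add_ac)

lemma clinear_vanishes_on_span:
  assumes "clinear f" "\<And>x. x \<in> B \<Longrightarrow> f x = 0" "x \<in> cspan B"
  shows "f x = 0"
  using assms(3)
proof (induction rule: complex_vector.span_induct_alt)
  case base
  show ?case by (simp add: clinear_simps[OF assms(1)])
next
  case (step c x y)
  then show ?case by (simp add: clinear_simps[OF assms(1)] assms(2))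
qed

lemma clinear_maps_span_into:
  assumes "clinear f" "csubspace T" "\<And>x. x \<in> B \<Longrightarrow> f x \<in> T" "x \<in> cspan B"
  shows "f x \<in> T"
  using assms(4)
proof (induction rule: complex_vector.span_induct_alt)
  case base
  show ?case by (simp add: clinear_simps[OF assms(1)] complex_vector.subspace_0[OF assms(2)])
next
  case (step c x y)
  then show ?case
    by (simp add: clinear_simps[OF assms(1)] assms(3)
        complex_vector.subspace_add[OF assms(2)] complex_vector.subspace_scale[OF assms(2)])
qed

lemma clinear_bracket_right: "clinear (bracket (x::'g::complex_lie_algebra))"
  by (rule clinearI) (simp_all add: bracket_add_right bracket_scaleC_right)

lemma clinear_bracket_left: "clinear (\<lambda>x. bracket x (y::'g::complex_lie_algebra))"
  by (rule clinearI) (simp_all add: bracket_add_left bracket_scaleC_left)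

lemmas bracket_linear_simps =
  clinear_simps(3-)[OF clinear_bracket_right] clinear_simps(3-)[OF clinear_bracket_left]

lemma bracket_antisymmetric: "bracket x y = - bracket y (x::'g::complex_lie_algebra)"
proof -
  have "bracket x y + bracket y x = 0"
    using bracket_self[of "x + y"] unfolding bracket_add_left bracket_add_right
    by (simp add: bracket_self add.commute)
  then show ?thesis by (simp only: eq_neg_iff_add_eq_0)
qed

lemma bracket_derivation:
  "bracket x (bracket y z) = bracket (bracket x y) z + bracket y (bracket x (z::'g::complex_lie_algebra))"
proof -
  have "bracket y (bracket z x) = - bracket y (bracket x z)"
    by (metis bracket_antisymmetric bracket_linear_simps(2))
  moreover have "bracket z (bracket x y) = - bracket (bracket x y) z"
    by (rule bracket_antisymmetric)
  ultimately show ?thesis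
    using bracket_jacobi[of x y z] by (simp add: algebra_simps)
qed

section \<open>Dual bases\<close>

text \<open>The difference of the two sides is linear in \<open>x\<close> and vanishes on the basis.\<close>

lemma dual_bases_finite_expansion:
  assumes "dual_bases form {..<n::nat} b S b' S'" "invariant_form form" "x \<in> S"
  shows "x = (\<Sum>j<n. form x (b' j) *\<^sub>C b j)"
proof -
  interpret invariant_form form by fact
  have B: "form (b j) (b' k) = (if j = k then 1 else 0)" if "j < n" "k < n" for j k
    using assms(1) that by (auto simp: dual_bases_def)
  have "x \<in> cspan (b ` {..<n})"
    using assms(1,3) by (simp add: dual_bases_def is_basis_def)
  moreover have L: "clinear (\<lambda>x. x - (\<Sum>j<n. form x (b' j) *\<^sub>C b j))"
    by (rule clinearI)
      (simp_all add: clinear_simps[OF linear_left] scaleC_complex_def scaleC_add_left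
        sum.distrib algebra_simps complex_vector.scale_sum_right complex_vector.scale_right_diff_distrib
        scaleC_add_right)
  ultimately have "x - (\<Sum>j<n. form x (b' j) *\<^sub>C b j) = 0"
    by (rule_tac clinear_vanishes_on_span[OF L, of "b ` {..<n}"])
      (auto simp: B if_distrib[of "\<lambda>c. c *\<^sub>C _"] cong: if_cong)
  then show ?thesis by simp
qed

lemma dual_bases_swap:
  assumes "dual_bases form J b S b' S'" "invariant_form form"
  shows "dual_bases form J b' S' b S"
  using assms invariant_form.symmetric[OF assms(2)] by (auto simp: dual_bases_def)

lemma dual_bases_mem:
  assumes "dual_bases form J b S b' S'" "j \<in> J"
  shows "b j \<in> S" "b' j \<in> S'"
  using assms by (auto simp: dual_bases_def is_basis_def intro: complex_vector.span_base)

section \<open>Weight vectors\<close>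

lemma subspace_root_space: "csubspace (root_space H \<mu>)"
  by (auto simp: complex_vector.subspace_def root_space_def bracket_linear_simps bracket_add_right
      bracket_scaleC_right scaleC_add_right scaleC_scaleC mult.commute)

lemma bracket_root_spaces:
  assumes "x \<in> root_space H \<mu>" "y \<in> root_space H \<nu>"
  shows "bracket x y \<in> root_space H (\<lambda>h. \<mu> h + \<nu> h)"
  using assms unfolding root_space_def
  by (auto simp: bracket_derivation[of _ x y] bracket_scaleC_left bracket_scaleC_right
      scaleC_add_left)

lemma dual_space_eqI:
  assumes "\<mu> \<in> dual_space H" "\<nu> \<in> dual_space H" "\<And>h. h \<in> H \<Longrightarrow> \<mu> h = \<nu> h"
  shows "\<mu> = \<nu>"
proof
  show "\<mu> h = \<nu> h" for h
    using assms by (cases "h \<in> H") (auto simp: dual_space_def)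
qed

text \<open>For \<open>h \<in> H\<close> the operator \<open>[h, \<cdot>] - \<kappa> h\<close> kills the component of weight \<open>\<kappa>\<close> and
  multiplies the one of weight \<open>\<mu>\<close> by \<open>\<mu> h - \<kappa> h\<close>, so a vanishing sum is reduced to a shorter
  one. A suitable \<open>h\<close> exists because elements of the dual space differ on \<open>H\<close>.\<close>

lemma weight_vectors_independent:
  assumes "finite S" "S \<subseteq> dual_space H" "\<And>\<mu>. \<mu> \<in> S \<Longrightarrow> f \<mu> \<in> root_space H \<mu>"
    and "(\<Sum>\<mu>\<in>S. f \<mu>) = 0" and "\<mu> \<in> S"
  shows "f \<mu> = 0"
  using assms
proof (induction S arbitrary: f \<mu> rule: finite_induct)
  case empty
  then show ?case by simp
next
  case (insert \<kappa> S)
  have vanish: "f \<mu> = 0" if "\<mu> \<in> S" for \<mu>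
  proof -
    have "(\<mu> h - \<kappa> h) *\<^sub>C f \<mu> = 0" if h: "h \<in> H" for h
    proof -
      have "(\<Sum>\<mu>\<in>insert \<kappa> S. (\<mu> h - \<kappa> h) *\<^sub>C f \<mu>) =
          bracket h (\<Sum>\<mu>\<in>insert \<kappa> S. f \<mu>) - \<kappa> h *\<^sub>C (\<Sum>\<mu>\<in>insert \<kappa> S. f \<mu>)"
        unfolding bracket_linear_simps complex_vector.scale_sum_right sum_subtractf[symmetric]
        using insert.prems(2) h
        by (intro sum.cong) (auto simp: root_space_def complex_vector.scale_left_diff_distrib)
      also have "\<dots> = 0"
        using insert.prems(3) by (simp add: bracket_linear_simps)
      finally have "(\<Sum>\<mu>\<in>S. (\<mu> h - \<kappa> h) *\<^sub>C f \<mu>) = 0"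
        using insert.hyps by simp
      then show ?thesis
        using insert.IH[of "\<lambda>\<mu>. (\<mu> h - \<kappa> h) *\<^sub>C f \<mu>"] insert.prems(1,2) \<open>\<mu> \<in> S\<close>
        by (simp add: complex_vector.subspace_scale[OF subspace_root_space])
    qed
    moreover have "\<exists>h\<in>H. \<mu> h \<noteq> \<kappa> h"
      using dual_space_eqI[of \<mu> H \<kappa>] insert.prems(1) insert.hyps that by auto
    ultimately show ?thesis by auto
  qed
  then have "f \<kappa> = 0"
    using insert.prems(3) insert.hyps by simp
  with vanish insert.prems(4) show ?case by auto
qed

lemma sum_of_subspaces_representation:
  assumes "x \<in> cspan (\<Union>\<mu>\<in>W. B \<mu>)" "\<And>\<mu>. \<mu> \<in> W \<Longrightarrow> csubspace (B \<mu>)"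
  shows "\<exists>S f. finite S \<and> S \<subseteq> W \<and> (\<forall>\<mu>\<in>S. f \<mu> \<in> B \<mu>) \<and> x = (\<Sum>\<mu>\<in>S. f \<mu>)"
  using assms(1)
proof (induction rule: complex_vector.span_induct_alt)
  case base
  show ?case by (intro exI[of _ "{}"]) auto
next
  case (step c y z)
  then obtain S f \<kappa> where S: "finite S" "S \<subseteq> W" "\<forall>\<mu>\<in>S. f \<mu> \<in> B \<mu>" "z = (\<Sum>\<mu>\<in>S. f \<mu>)"
    and \<kappa>: "\<kappa> \<in> W" "y \<in> B \<kappa>" by auto
  define g where "g = (\<lambda>\<mu>. (if \<mu> \<in> S then f \<mu> else 0) + (if \<mu> = \<kappa> then c *\<^sub>C y else 0))"
  have "(\<Sum>\<mu>\<in>insert \<kappa> S. g \<mu>) = (\<Sum>\<mu>\<in>insert \<kappa> S. if \<mu> \<in> S then f \<mu> else 0) + c *\<^sub>C y"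
    using S(1) by (simp add: g_def sum.distrib)
  also have "(\<Sum>\<mu>\<in>insert \<kappa> S. if \<mu> \<in> S then f \<mu> else 0) = z"
    unfolding S(4) using S(1) by (intro sum.mono_neutral_cong_right) auto
  finally have "c *\<^sub>C y + z = (\<Sum>\<mu>\<in>insert \<kappa> S. g \<mu>)" by (simp add: add.commute)
  moreover have "\<forall>\<mu>\<in>insert \<kappa> S. g \<mu> \<in> B \<mu>"
    using S \<kappa> assms(2) unfolding g_def
    by (auto intro!: complex_vector.subspace_add complex_vector.subspace_scale
        simp: complex_vector.subspace_0)
  ultimately show ?case
    using S(1,2) \<kappa>(1) by (intro exI[of _ "insert \<kappa> S"] exI[of _ g]) auto
qed

text \<open>If subspaces of weight spaces span the whole space, then they are the whole weight spaces and
  no further weights occur: a weight vector and its decomposition into components can be compared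
  by independence. The \<open>B \<mu>\<close> are kept separate from the weight spaces so that
  \<open>B 0 = H\<close> yields that the weight space of 0 is \<open>H\<close>.\<close>

lemma weight_vector_in_component:
  assumes "cspan (\<Union>\<mu>\<in>W. B \<mu>) = UNIV" "W \<subseteq> dual_space H"
    and "\<And>\<mu>. \<mu> \<in> W \<Longrightarrow> csubspace (B \<mu>)" "\<And>\<mu>. \<mu> \<in> W \<Longrightarrow> B \<mu> \<subseteq> root_space H \<mu>"
    and "\<kappa> \<in> dual_space H" "x \<in> root_space H \<kappa>" "x \<noteq> 0"
  shows "\<kappa> \<in> W \<and> x \<in> B \<kappa>"
proof -
  obtain S f where S: "finite S" "S \<subseteq> W" "\<forall>\<mu>\<in>S. f \<mu> \<in> B \<mu>" "x = (\<Sum>\<mu>\<in>S. f \<mu>)"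
    using sum_of_subspaces_representation[of x B W] assms(1,3) by auto
  define g where "g = (\<lambda>\<mu>. (if \<mu> \<in> S then f \<mu> else 0) - (if \<mu> = \<kappa> then x else 0))"
  have "(\<Sum>\<mu>\<in>insert \<kappa> S. g \<mu>) = (\<Sum>\<mu>\<in>insert \<kappa> S. if \<mu> \<in> S then f \<mu> else 0) - x"
    using S(1) by (simp add: g_def sum_subtractf)
  also have "(\<Sum>\<mu>\<in>insert \<kappa> S. if \<mu> \<in> S then f \<mu> else 0) = x"
    unfolding S(4) using S(1) by (intro sum.mono_neutral_cong_right) auto
  finally have "(\<Sum>\<mu>\<in>insert \<kappa> S. g \<mu>) = 0" by simp
  moreover have "g \<mu> \<in> root_space H \<mu>" if "\<mu> \<in> insert \<kappa> S" for \<mu>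
    unfolding g_def
    by (intro complex_vector.subspace_diff subspace_root_space)
      (use S assms(4,6) complex_vector.subspace_0[OF subspace_root_space] in auto)
  ultimately have "g \<kappa> = 0"
    using weight_vectors_independent[of "insert \<kappa> S" H g \<kappa>] S assms(2,5) by auto
  then show ?thesis
    using assms(7) S by (auto simp: g_def split: if_splits)
qed

section \<open>Triangular decomposition\<close>

inductive_set iterated_brackets :: "('i \<Rightarrow> 'g::complex_lie_algebra) \<Rightarrow> 'g set" for X where
  generator: "X i \<in> iterated_brackets X"
| bracket: "x \<in> iterated_brackets X \<Longrightarrow> bracket (X i) x \<in> iterated_brackets X"

context kac_moody_algebra
begin

text \<open>The data are symmetric under the exchange of \<open>E\<close> and \<open>F\<close> with a change of sign of roots
  and coroots (the Chevalley involution). Each statement on the \<open>E i\<close> thereby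
  gives one on the \<open>F i\<close>.\<close>

lemma opposite: "kac_moody_algebra C H (\<lambda>i h. - \<alpha> i h) (\<lambda>i. - \<alpha>c i) F E"
proof
  show "generalized_cartan_matrix C" "csubspace H" by (rule gcm subspace_H)+
  show "(\<lambda>h. - \<alpha> i h) \<in> dual_space H" for i
    using simple_root[of i] by (auto simp: dual_space_def)
  show "- \<alpha>c i \<in> H" for i
    by (rule complex_vector.subspace_neg[OF subspace_H simple_coroot])
  show "c i = 0" if "\<forall>h. (\<Sum>i\<in>UNIV. c i * - \<alpha> i h) = 0" for c i
    using that by (intro independent_roots) (simp add: sum_negf)
  show "c i = 0" if "(\<Sum>i\<in>UNIV. c i *\<^sub>C - \<alpha>c i) = 0" for c i
    using that by (intro independent_coroots) (simp add: sum_negf)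
  have "\<alpha> j (- \<alpha>c i) = - \<alpha> j (\<alpha>c i)" for i j
  proof -
    have "\<alpha> j ((-1) *\<^sub>C \<alpha>c i) = (-1) * \<alpha> j (\<alpha>c i)"
      using simple_root[of j] simple_coroot[of i] unfolding dual_space_def by blast
    then show ?thesis by simp
  qed
  then show "- \<alpha> j (- \<alpha>c i) = of_int (C $ i $ j)" for i j
    by (simp add: root_coroot)
  show "cdim H + rank (complex_matrix C) = 2 * CARD('i)" by (rule dim_H)
  show "bracket (F i) (E j) = (if i = j then - \<alpha>c i else 0)" for i j
    by (subst bracket_antisymmetric) (simp add: bracket_E_F)
  show "bracket h h' = 0" if "h \<in> H" "h' \<in> H" for h h'
    using that by (rule bracket_H_H)
  show "bracket h (F i) = - \<alpha> i h *\<^sub>C F i" "bracket h (E i) = - (- \<alpha> i h *\<^sub>C E i)"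
    if "h \<in> H" for h i
    using that by (simp_all add: bracket_H_E bracket_H_F)
  show "S = UNIV" if "lie_subalgebra S" "H \<union> range F \<union> range E \<subseteq> S" for S
    using that by (intro generated) auto
  show "I = {0}" if "lie_ideal I" "I \<inter> H = {0}" for I
    using that by (rule no_ideal)
qed

lemma E_in_root_space: "E i \<in> root_space H (\<alpha> i)"
  by (simp add: root_space_def bracket_H_E)

lemma F_in_root_space: "F i \<in> root_space H (\<lambda>h. - \<alpha> i h)"
  by (simp add: root_space_def bracket_H_F)

lemma root_comb_add_simple:
  "root_comb \<alpha> (n(i := Suc (n i))) = (\<lambda>h. \<alpha> i h + root_comb \<alpha> n h)"
proof
  fix h
  have "root_comb \<alpha> (n(i := Suc (n i))) h =
      (\<Sum>j\<in>UNIV. of_nat (n j) * \<alpha> j h + (if j = i then \<alpha> i h else 0))"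
    unfolding root_comb_def by (intro sum.cong) (auto simp: algebra_simps)
  then show "root_comb \<alpha> (n(i := Suc (n i))) h = \<alpha> i h + root_comb \<alpha> n h"
    by (simp add: sum.distrib root_comb_def)
qed

lemma root_comb_zero: "root_comb \<alpha> (\<lambda>_. 0) = (\<lambda>h. 0)"
  by (simp add: root_comb_def)

lemma simple_root_as_root_comb: "\<alpha> i = root_comb \<alpha> ((\<lambda>_. 0)(i := 1))"
  using root_comb_add_simple[of "\<lambda>_. 0" i] by (simp add: root_comb_zero)

lemma root_comb_add:
  "root_comb \<alpha> (\<lambda>i. m i + n i) = (\<lambda>h. root_comb \<alpha> m h + root_comb \<alpha> n h)"
  by (simp add: root_comb_def fun_eq_iff algebra_simps sum.distrib)

lemma inj_root_comb: "inj (root_comb \<alpha>)"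
proof (rule injI)
  fix m n assume "root_comb \<alpha> m = root_comb \<alpha> n"
  then have "\<forall>h. (\<Sum>i\<in>UNIV. (of_nat (m i) - of_nat (n i)) * \<alpha> i h) = 0"
    by (simp add: root_comb_def fun_eq_iff algebra_simps sum_subtractf)
  then have "of_nat (m i) - of_nat (n i) = (0::complex)" for i
    by (rule independent_roots)
  then show "m = n" by (simp add: fun_eq_iff)
qed

lemma root_comb_eq_zero_iff: "root_comb \<alpha> n = (\<lambda>h. 0) \<longleftrightarrow> n = (\<lambda>_. 0)"
  using inj_root_comb root_comb_zero by (metis injD)

lemma root_comb_in_dual_space: "root_comb \<alpha> n \<in> dual_space H"
proof -
  have "\<alpha> i (x + y) = \<alpha> i x + \<alpha> i y" "\<alpha> i (c *\<^sub>C x) = c * \<alpha> i x" if "x \<in> H" "y \<in> H" for i c x y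
    using simple_root[of i] that by (auto simp: dual_space_def)
  moreover have "\<alpha> i x = 0" if "x \<notin> H" for i x
    using simple_root[of i] that by (auto simp: dual_space_def)
  ultimately show ?thesis
    by (auto simp: dual_space_def root_comb_def algebra_simps sum.distrib sum_distrib_left)
qed

lemma iterated_E_weight:
  "x \<in> iterated_brackets E \<Longrightarrow> \<exists>n. n \<noteq> (\<lambda>_. 0) \<and> x \<in> root_space H (root_comb \<alpha> n)"
proof (induction rule: iterated_brackets.induct)
  case (generator i)
  have "(\<lambda>_. 0)(i := 1::nat) \<noteq> (\<lambda>_. 0)" by (metis fun_upd_same zero_neq_one)
  then show ?case
    using E_in_root_space[of i] simple_root_as_root_comb[of i] by metis
next
  case (bracket x i)
  then obtain n where "x \<in> root_space H (root_comb \<alpha> n)" by auto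
  then have "bracket (E i) x \<in> root_space H (root_comb \<alpha> (n(i := Suc (n i))))"
    unfolding root_comb_add_simple by (rule bracket_root_spaces[OF E_in_root_space])
  moreover have "n(i := Suc (n i)) \<noteq> (\<lambda>_. 0)" by (metis fun_upd_same nat.distinct(1))
  ultimately show ?case by blast
qed

text \<open>Passing \<open>E i\<close> through an iterated bracket of the \<open>F j\<close> turns each factor \<open>F i\<close> that it
  meets into a coroot, which acts by a scalar on the weight vector to its right. For a
  single \<open>F i\<close> the result is the coroot itself, so \<open>H\<close> has to be added to the span.\<close>

lemma bracket_E_iterated_F:
  assumes "y \<in> iterated_brackets F"
  shows "bracket (E i) y \<in> cspan (H \<union> iterated_brackets F)"
  using assms
proof (induction rule: iterated_brackets.induct)
  case (generator j)
  show ?case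
    using simple_coroot[of i]
    by (auto simp: bracket_E_F complex_vector.span_zero intro: complex_vector.span_base)
next
  case (bracket y j)
  let ?T = "cspan (H \<union> iterated_brackets F)"
  have "bracket (\<alpha>c i) y \<in> ?T"
  proof -
    obtain n where "y \<in> root_space H (root_comb (\<lambda>i h. - \<alpha> i h) n)"
      using kac_moody_algebra.iterated_E_weight[OF opposite bracket.hyps] by auto
    then have "bracket (\<alpha>c i) y = root_comb (\<lambda>i h. - \<alpha> i h) n (\<alpha>c i) *\<^sub>C y"
      using simple_coroot[of i] by (simp add: root_space_def)
    then show ?thesis
      using bracket.hyps by (simp add: complex_vector.span_scale complex_vector.span_base)
  qed
  moreover have "bracket (F j) (bracket (E i) y) \<in> ?T"
  proof (rule clinear_maps_span_into[OF clinear_bracket_right complex_vector.subspace_span _ bracket.IH])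
    fix x assume "x \<in> H \<union> iterated_brackets F"
    then show "bracket (F j) x \<in> ?T"
    proof
      assume "x \<in> H"
      then have "bracket (F j) x = \<alpha> j x *\<^sub>C F j"
        by (subst bracket_antisymmetric) (simp add: bracket_H_F)
      then show ?thesis
        by (simp add: complex_vector.span_scale complex_vector.span_base iterated_brackets.generator)
    next
      assume "x \<in> iterated_brackets F"
      then show ?thesis
        by (intro complex_vector.span_base UnI2 iterated_brackets.bracket)
    qed
  qed
  ultimately show ?case
    by (auto simp: bracket_derivation[of "E i"] bracket_E_F bracket_linear_simps
        intro: complex_vector.span_add)
qed

lemma bracket_E_stable:
  assumes "y \<in> cspan (H \<union> iterated_brackets E \<union> iterated_brackets F)"
  shows "bracket (E i) y \<in> cspan (H \<union> iterated_brackets E \<union> iterated_brackets F)"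
proof (rule clinear_maps_span_into[OF clinear_bracket_right complex_vector.subspace_span _ assms])
  let ?T = "cspan (H \<union> iterated_brackets E \<union> iterated_brackets F)"
  fix x assume "x \<in> H \<union> iterated_brackets E \<union> iterated_brackets F"
  then consider "x \<in> H" | "x \<in> iterated_brackets E" | "x \<in> iterated_brackets F" by auto
  then show "bracket (E i) x \<in> ?T"
  proof cases
    case 1
    then have "bracket (E i) x = - (\<alpha> i x *\<^sub>C E i)"
      by (subst bracket_antisymmetric) (simp add: bracket_H_E)
    then show ?thesis
      by (simp add: complex_vector.span_neg complex_vector.span_scale complex_vector.span_base
          iterated_brackets.generator)
  next
    case 2
    then show ?thesis
      by (intro complex_vector.span_base UnI1 UnI2 iterated_brackets.bracket)
  next
    case 3
    have "cspan (H \<union> iterated_brackets F) \<subseteq> ?T"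
      by (rule complex_vector.span_mono) auto
    with bracket_E_iterated_F[OF 3] show ?thesis by auto
  qed
qed

text \<open>The elements whose brackets preserve the span form a subalgebra by the Jacobi identity, and
  they include the generators, so all brackets preserve the span. Hence the span is itself a
  subalgebra that contains the generators.\<close>

lemma triangular_decomposition:
  "cspan (H \<union> iterated_brackets E \<union> iterated_brackets F) = UNIV" (is "?T = _")
proof -
  interpret opp: kac_moody_algebra C H "\<lambda>i h. - \<alpha> i h" "\<lambda>i. - \<alpha>c i" F E
    by (rule opposite)
  have F_stable: "bracket (F i) y \<in> ?T" if "y \<in> ?T" for i y
    using opp.bracket_E_stable[of y i] that by (simp add: Un_ac)
  have H_stable: "bracket h y \<in> ?T" if "h \<in> H" "y \<in> ?T" for h y
  proof (rule clinear_maps_span_into[OF clinear_bracket_right complex_vector.subspace_span _ that(2)])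
    fix x assume x: "x \<in> H \<union> iterated_brackets E \<union> iterated_brackets F"
    have "\<exists>c. bracket h x = c *\<^sub>C x"
      using x
    proof (elim UnE)
      assume "x \<in> H"
      then have "bracket h x = 0 *\<^sub>C x" using that(1) by (simp add: bracket_H_H)
      then show ?thesis by blast
    next
      assume "x \<in> iterated_brackets E"
      then show ?thesis
        using iterated_E_weight that(1) by (auto simp: root_space_def)
    next
      assume "x \<in> iterated_brackets F"
      then show ?thesis
        using opp.iterated_E_weight that(1) by (auto simp: root_space_def)
    qed
    then show "bracket h x \<in> ?T"
      using x by (auto intro!: complex_vector.span_scale intro: complex_vector.span_base)
  qed
  let ?N = "{x. \<forall>y\<in>?T. bracket x y \<in> ?T}"
  have "?N = UNIV"
  proof (rule generated)
    show "lie_subalgebra ?N"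
      unfolding lie_subalgebra_def complex_vector.subspace_def
    proof (intro conjI ballI allI CollectI)
      fix x z y assume *: "x \<in> ?N" "z \<in> ?N" "y \<in> ?T"
      have "bracket (bracket x z) y = bracket x (bracket z y) - bracket z (bracket x y)"
        by (simp add: bracket_derivation[of x])
      then show "bracket (bracket x z) y \<in> ?T"
        using * by (simp add: complex_vector.span_diff)
    qed (auto simp: bracket_linear_simps bracket_add_left bracket_scaleC_left
        intro: complex_vector.span_zero complex_vector.span_add complex_vector.span_scale)
    show "H \<union> range E \<union> range F \<subseteq> ?N"
      using bracket_E_stable F_stable H_stable by auto
  qed
  then have "bracket x y \<in> ?T" if "y \<in> ?T" for x y
    using that by auto
  then have "lie_subalgebra ?T"
    by (simp add: lie_subalgebra_def complex_vector.subspace_span)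
  moreover have "H \<union> range E \<union> range F \<subseteq> ?T"
    by (auto intro: complex_vector.span_base iterated_brackets.generator)
  ultimately show ?thesis by (rule generated)
qed

definition signed_root_combs :: "('g \<Rightarrow> complex) set" where
  "signed_root_combs = {\<mu>. \<exists>n. \<mu> = root_comb \<alpha> n \<or> \<mu> = (\<lambda>h. - root_comb \<alpha> n h)}"

text \<open>In weight 0 only \<open>H\<close> is needed, as no iterated bracket has weight 0. This is what
  identifies the whole weight space of 0.\<close>

lemma span_root_spaces:
  "cspan (\<Union>\<mu>\<in>signed_root_combs. if \<mu> = (\<lambda>h. 0) then H else root_space H \<mu>) = UNIV"
    (is "cspan ?U = _")
proof -
  have E: "iterated_brackets E \<subseteq> ?U"
  proof
    fix x assume "x \<in> iterated_brackets E"
    then obtain n where "n \<noteq> (\<lambda>_. 0)" "x \<in> root_space H (root_comb \<alpha> n)"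
      using iterated_E_weight by blast
    then show "x \<in> ?U"
      by (intro UN_I[of "root_comb \<alpha> n"]) (auto simp: root_comb_eq_zero_iff signed_root_combs_def)
  qed
  have F: "iterated_brackets F \<subseteq> ?U"
  proof
    fix x assume "x \<in> iterated_brackets F"
    then obtain n where n: "n \<noteq> (\<lambda>_. 0)" "x \<in> root_space H (root_comb (\<lambda>i h. - \<alpha> i h) n)"
      using kac_moody_algebra.iterated_E_weight[OF opposite] by blast
    have "root_comb (\<lambda>i h. - \<alpha> i h) n = (\<lambda>h. - root_comb \<alpha> n h)"
      by (simp add: root_comb_def sum_negf)
    moreover have "(\<lambda>h. - root_comb \<alpha> n h) \<noteq> (\<lambda>h. 0)"
      using n(1) root_comb_eq_zero_iff[of n] by (auto simp: fun_eq_iff)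
    ultimately show "x \<in> ?U"
      using n by (intro UN_I[of "\<lambda>h. - root_comb \<alpha> n h"]) (auto simp: signed_root_combs_def)
  qed
  have "H \<subseteq> ?U"
    using root_comb_zero
    by (intro subsetI UN_I[of "\<lambda>h. 0"]) (auto simp: signed_root_combs_def intro!: exI[of _ "\<lambda>_. 0"])
  with E F have "cspan (H \<union> iterated_brackets E \<union> iterated_brackets F) \<subseteq> cspan ?U"
    by (intro complex_vector.span_mono) auto
  then show ?thesis using triangular_decomposition by auto
qed

lemma weight_vector_cases:
  assumes "\<mu> \<in> dual_space H" "x \<in> root_space H \<mu>" "x \<noteq> 0"
  shows "\<mu> \<in> signed_root_combs" and "\<mu> = (\<lambda>h. 0) \<Longrightarrow> x \<in> H"
proof -
  have "H \<subseteq> root_space H (\<lambda>h. 0)"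
    by (auto simp: root_space_def bracket_H_H)
  moreover have "signed_root_combs \<subseteq> dual_space H"
    using root_comb_in_dual_space by (auto simp: signed_root_combs_def dual_space_def)
  ultimately have "\<mu> \<in> signed_root_combs \<and> x \<in> (if \<mu> = (\<lambda>h. 0) then H else root_space H \<mu>)"
    using assms subspace_H subspace_root_space
    by (intro weight_vector_in_component[OF span_root_spaces]) auto
  then show "\<mu> \<in> signed_root_combs" and "\<mu> = (\<lambda>h. 0) \<Longrightarrow> x \<in> H" by auto
qed

end

section \<open>Simple roots and heights\<close>

context kac_moody_algebra
begin

lemma simple_root_in_positive_roots: "\<alpha> i \<in> positive_roots H \<alpha>"
proof -
  have "E i \<noteq> 0"
  proof
    assume "E i = 0"
    then have "\<alpha>c i = 0" using bracket_E_F[of i i] by (simp add: bracket_linear_simps)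
    then have "(\<Sum>j\<in>UNIV. (if j = i then 1 else 0) *\<^sub>C \<alpha>c j) = 0"
      by (intro sum.neutral) auto
    from independent_coroots[OF this, of i] show False by simp
  qed
  moreover have "\<alpha> i \<noteq> (\<lambda>h. 0)"
    using root_comb_eq_zero_iff[of "(\<lambda>_. 0)(i := 1)"] simple_root_as_root_comb[of i]
    by (metis fun_upd_same zero_neq_one)
  ultimately show ?thesis
    using E_in_root_space[of i] simple_root[of i] simple_root_as_root_comb[of i]
    by (auto simp: positive_roots_def roots_def)
qed

lemma positive_root_add_simple:
  assumes "\<beta> \<in> positive_roots H \<alpha>" "(\<lambda>h. \<beta> h + \<alpha> i h) \<notin> positive_roots H \<alpha>"
  shows "root_space H (\<lambda>h. \<beta> h + \<alpha> i h) = {0}"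
proof -
  obtain n where "\<beta> = root_comb \<alpha> n" using assms(1) by (auto simp: positive_roots_def)
  then have eq: "(\<lambda>h. \<beta> h + \<alpha> i h) = root_comb \<alpha> (n(i := Suc (n i)))"
    unfolding root_comb_add_simple by (simp add: add.commute)
  moreover have "n(i := Suc (n i)) \<noteq> (\<lambda>_. 0)" by (metis fun_upd_same nat.distinct(1))
  ultimately show ?thesis
    using assms(2) root_comb_in_dual_space[of "n(i := Suc (n i))"]
      root_comb_eq_zero_iff[of "n(i := Suc (n i))"]
    unfolding positive_roots_def roots_def by auto
qed

text \<open>If \<open>\<gamma> - \<alpha> i\<close> were a weight but not a positive root, it would be \<open>- root_comb \<alpha> n\<close>.
  Then \<open>\<gamma>\<close> and \<open>root_comb \<alpha> n\<close> add up to the simple root \<open>\<alpha> i\<close>, which forces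
  \<open>\<gamma> = \<alpha> i\<close>, since the coefficients are natural numbers.\<close>

lemma positive_root_diff_simple:
  assumes "\<gamma> \<in> positive_roots H \<alpha>" "\<gamma> \<noteq> \<alpha> i" "(\<lambda>h. \<gamma> h - \<alpha> i h) \<notin> positive_roots H \<alpha>"
  shows "root_space H (\<lambda>h. \<gamma> h - \<alpha> i h) = {0}"
proof (rule ccontr)
  let ?\<beta> = "\<lambda>h. \<gamma> h - \<alpha> i h"
  assume nz: "root_space H ?\<beta> \<noteq> {0}"
  then obtain x where x: "x \<in> root_space H ?\<beta>" "x \<noteq> 0"
    using complex_vector.subspace_0[OF subspace_root_space] by blast
  obtain m where m: "\<gamma> = root_comb \<alpha> m" using assms(1) by (auto simp: positive_roots_def)
  have m0: "m \<noteq> (\<lambda>_. 0)"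
    using assms(1) root_comb_zero m by (auto simp: positive_roots_def roots_def)
  have dual: "?\<beta> \<in> dual_space H"
    using root_comb_in_dual_space[of m] simple_root[of i]
    by (auto simp: m dual_space_def algebra_simps)
  have "?\<beta> \<noteq> (\<lambda>h. 0)" using assms(2) by (auto simp: fun_eq_iff)
  then have "?\<beta> \<noteq> root_comb \<alpha> n" for n
    using assms(3) dual nz by (auto simp: positive_roots_def roots_def)
  then obtain n where n: "?\<beta> = (\<lambda>h. - root_comb \<alpha> n h)"
    using weight_vector_cases(1)[OF dual x] by (auto simp: signed_root_combs_def)
  have "root_comb \<alpha> m h + root_comb \<alpha> n h = \<alpha> i h" for h
    using fun_cong[OF n, of h] by (simp add: m algebra_simps)
  then have "root_comb \<alpha> (\<lambda>j. m j + n j) = root_comb \<alpha> ((\<lambda>_. 0)(i := 1))"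
    unfolding root_comb_add simple_root_as_root_comb[of i, symmetric] by (simp add: fun_eq_iff)
  then have sum: "(\<lambda>j. m j + n j) = (\<lambda>_. 0)(i := 1)"
    by (rule injD[OF inj_root_comb])
  have "m = (\<lambda>_. 0)(i := 1)"
  proof
    fix j
    have "m j = 0" if "j \<noteq> i" for j using fun_cong[OF sum, of j] that by simp
    moreover from this m0 have "m i \<noteq> 0" by metis
    ultimately show "m j = ((\<lambda>_. 0)(i := 1)) j"
      using fun_cong[OF sum, of i] by auto
  qed
  then show False using assms(2) m simple_root_as_root_comb[of i] by simp
qed

lemma height_root_comb: "height \<alpha> (root_comb \<alpha> n) = (\<Sum>i\<in>UNIV. n i)"
  unfolding height_def using inj_root_comb by (auto dest: injD)

lemma finite_positive_roots_below: "finite {\<beta> \<in> positive_roots H \<alpha>. height \<alpha> \<beta> < N}"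
proof (rule finite_subset)
  show "{\<beta> \<in> positive_roots H \<alpha>. height \<alpha> \<beta> < N} \<subseteq> root_comb \<alpha> ` (PiE UNIV (\<lambda>_. {..<N}))"
  proof
    fix \<beta> assume "\<beta> \<in> {\<beta> \<in> positive_roots H \<alpha>. height \<alpha> \<beta> < N}"
    then obtain n where n: "\<beta> = root_comb \<alpha> n" "(\<Sum>i\<in>UNIV. n i) < N"
      by (auto simp: positive_roots_def height_root_comb)
    have "n i < N" for i
      using n(2) member_le_sum[of i UNIV n] by auto
    then show "\<beta> \<in> root_comb \<alpha> ` (PiE UNIV (\<lambda>_. {..<N}))"
      using n(1) by auto
  qed
  show "finite (root_comb \<alpha> ` (PiE (UNIV::'i set) (\<lambda>_. {..<N})))"
    by (intro finite_imageI finite_PiE) auto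
qed

end

section \<open>The invariant form and the root spaces\<close>

context invariant_form
begin

lemma form_scaleC: "form (c *\<^sub>C x) y = c * form x y" "form x (c *\<^sub>C y) = c * form x y"
  by (simp_all add: clinear_simps(2)[OF linear_left] clinear_simps(2)[OF linear_right]
      scaleC_complex_def)

lemmas form_linear_simps =
  form_scaleC clinear_simps(1)[OF linear_left] clinear_simps(1)[OF linear_right]
  clinear_simps(3-)[OF linear_left] clinear_simps(3-)[OF linear_right]

lemma invariant_skew: "form (bracket z x) y = - form x (bracket z y)"
  by (subst bracket_antisymmetric) (simp add: form_linear_simps invariant)

lemma root_spaces_orthogonal:
  assumes "x \<in> root_space H \<mu>" "y \<in> root_space H \<nu>" "h \<in> H" "\<mu> h + \<nu> h \<noteq> 0"
  shows "form x y = 0"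
proof -
  have "(\<mu> h + \<nu> h) * form x y = 0"
    using invariant_skew[of h x y] assms(1-3)
    by (simp add: root_space_def form_linear_simps algebra_simps)
  with assms(4) show ?thesis by simp
qed

end

locale kac_moody_form = kac_moody_algebra C H \<alpha> \<alpha>c E F + invariant_form form
  for C :: "int^'i^'i" and H :: "'g::complex_lie_algebra set" and \<alpha> :: "'i \<Rightarrow> 'g \<Rightarrow> complex"
    and \<alpha>c E F :: "'i \<Rightarrow> 'g" and form :: "'g \<Rightarrow> 'g \<Rightarrow> complex" +
  fixes u u' :: "nat \<Rightarrow> 'g"
  assumes cartan_bases: "dual_bases form {..<cdim H} u H u' H"
begin

lemma cartan_expansion: "h \<in> H \<Longrightarrow> h = (\<Sum>k<cdim H. form h (u' k) *\<^sub>C u k)"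
  and cartan_expansion': "h \<in> H \<Longrightarrow> h = (\<Sum>k<cdim H. form h (u k) *\<^sub>C u' k)"
  using dual_bases_finite_expansion[OF cartan_bases invariant_form_axioms]
    dual_bases_finite_expansion[OF dual_bases_swap[OF cartan_bases invariant_form_axioms]
      invariant_form_axioms] by blast+

lemma cartan_basis_mem: "k < cdim H \<Longrightarrow> u k \<in> H" "k < cdim H \<Longrightarrow> u' k \<in> H"
  using dual_bases_mem[OF cartan_bases] by auto

lemma dual_space_sum:
  assumes "\<phi> \<in> dual_space H" "\<And>k. k \<in> K \<Longrightarrow> x k \<in> H"
  shows "\<phi> (\<Sum>k\<in>K. c k *\<^sub>C x k) = (\<Sum>k\<in>K. c k * \<phi> (x k))"
proof -
  have add: "\<phi> (x + y) = \<phi> x + \<phi> y" and scale: "\<phi> (c *\<^sub>C x) = c * \<phi> x"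
    if "x \<in> H" "y \<in> H" for x y c
    using assms(1) that by (auto simp: dual_space_def)
  have zero: "\<phi> 0 = 0"
    using scale[of 0 0 0] complex_vector.subspace_0[OF subspace_H] by simp
  show ?thesis
    using assms(2)
  proof (induction K rule: infinite_finite_induct)
    case (insert k K)
    have "(\<Sum>k\<in>K. c k *\<^sub>C x k) \<in> H"
      using insert.prems by (intro complex_vector.subspace_sum complex_vector.subspace_scale subspace_H) auto
    then show ?case
      using insert complex_vector.subspace_scale[OF subspace_H]
      by (simp add: add scale)
  qed (simp_all add: zero)
qed

text \<open>On \<open>H\<close> the form is non-degenerate because \<open>H\<close> has dual bases. They also yield the
  preimage of \<open>\<phi>\<close> explicitly, which makes the choice in \<^const>\<open>nu_inv\<close> a true inverse.\<close>

lemma nu_inv: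
  assumes "\<phi> \<in> dual_space H"
  shows nu_inv_mem: "nu_inv H form \<phi> \<in> H"
    and form_nu_inv: "h \<in> H \<Longrightarrow> form (nu_inv H form \<phi>) h = \<phi> h"
proof -
  let ?t = "\<Sum>k<cdim H. \<phi> (u' k) *\<^sub>C u k"
  have t: "?t \<in> H"
    using cartan_basis_mem
    by (intro complex_vector.subspace_sum complex_vector.subspace_scale subspace_H) auto
  have "form ?t x = \<phi> x" if "x \<in> H" for x
  proof -
    have "\<phi> x = (\<Sum>k<cdim H. form x (u k) * \<phi> (u' k))"
      using dual_space_sum[OF assms, of "{..<cdim H}" u' "\<lambda>k. form x (u k)"]
        cartan_expansion'[OF that] cartan_basis_mem by auto
    then show ?thesis
      by (simp add: form_linear_simps symmetric[of x] mult.commute)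
  qed
  then have "nu H form ?t = \<phi>"
    using assms by (auto simp: nu_def dual_space_def fun_eq_iff)
  with t have img: "\<phi> \<in> nu H form ` H" by (metis imageI)
  show "nu_inv H form \<phi> \<in> H"
    unfolding nu_inv_def by (rule inv_into_into[OF img])
  have "nu H form (nu_inv H form \<phi>) = \<phi>"
    unfolding nu_inv_def by (rule f_inv_into_f[OF img])
  then show "h \<in> H \<Longrightarrow> form (nu_inv H form \<phi>) h = \<phi> h"
    by (metis nu_def)
qed

lemma nu_inv_unique:
  assumes "\<phi> \<in> dual_space H" "t \<in> H" "\<And>h. h \<in> H \<Longrightarrow> form t h = \<phi> h"
  shows "t = nu_inv H form \<phi>"
proof -
  let ?d = "t - nu_inv H form \<phi>"
  have "?d \<in> H" using assms(1,2) by (intro complex_vector.subspace_diff subspace_H nu_inv_mem)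
  then have "?d = (\<Sum>k<cdim H. form ?d (u' k) *\<^sub>C u k)" by (rule cartan_expansion)
  also have "\<dots> = 0"
    using assms cartan_basis_mem by (intro sum.neutral) (auto simp: form_linear_simps form_nu_inv)
  finally show ?thesis by simp
qed

lemma nu_inv_expansion:
  assumes "\<phi> \<in> dual_space H"
  shows "(\<Sum>k<cdim H. \<phi> (u' k) *\<^sub>C u k) = nu_inv H form \<phi>"
    and "(\<Sum>k<cdim H. \<phi> (u k) *\<^sub>C u' k) = nu_inv H form \<phi>"
  using cartan_expansion[OF nu_inv_mem[OF assms]] cartan_expansion'[OF nu_inv_mem[OF assms]]
    cartan_basis_mem form_nu_inv[OF assms] by auto

lemma neg_dual_space: "\<phi> \<in> dual_space H \<Longrightarrow> (\<lambda>h. - \<phi> h) \<in> dual_space H"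
  by (auto simp: dual_space_def)

lemma nu_inv_neg:
  assumes "\<phi> \<in> dual_space H"
  shows "nu_inv H form (\<lambda>h. - \<phi> h) = - nu_inv H form \<phi>"
  using assms neg_dual_space
  by (intro nu_inv_unique[symmetric] complex_vector.subspace_neg subspace_H nu_inv_mem)
    (auto simp: form_linear_simps form_nu_inv)

text \<open>An element of weight \<open>-\<mu>\<close> pairs to 0 with every weight space except that of weight \<open>\<mu>\<close>. If
  that one is trivial, the element lies in the radical of the form.\<close>

lemma root_space_neg_trivial:
  assumes "\<mu> \<in> dual_space H" "\<mu> \<noteq> (\<lambda>h. 0)" "root_space H \<mu> = {0}"
  shows "root_space H (\<lambda>h. - \<mu> h) = {0}"
proof -
  have "y = 0" if y: "y \<in> root_space H (\<lambda>h. - \<mu> h)" for y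
  proof (rule nondegenerate)
    fix z
    show "form y z = 0"
    proof (rule clinear_vanishes_on_span[OF linear_right])
      show "z \<in> cspan (\<Union>\<mu>\<in>signed_root_combs. if \<mu> = (\<lambda>h. 0) then H else root_space H \<mu>)"
        unfolding span_root_spaces by (rule UNIV_I)
    next
      fix x assume "x \<in> (\<Union>\<mu>\<in>signed_root_combs. if \<mu> = (\<lambda>h. 0) then H else root_space H \<mu>)"
      then obtain \<kappa> where \<kappa>: "\<kappa> \<in> signed_root_combs" and x: "x \<in> (if \<kappa> = (\<lambda>h. 0) then H else root_space H \<kappa>)"
        by (rule UN_E)
      have "\<kappa> \<in> dual_space H"
        using \<kappa> root_comb_in_dual_space neg_dual_space by (auto simp: signed_root_combs_def)
      show "form y x = 0"
      proof (cases "\<kappa> = \<mu>")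
        case True
        with x assms(2,3) show ?thesis by (simp add: form_linear_simps)
      next
        case False
        then obtain h where "h \<in> H" "\<kappa> h \<noteq> \<mu> h"
          using dual_space_eqI[OF \<open>\<kappa> \<in> dual_space H\<close> assms(1)] by auto
        moreover have "x \<in> root_space H \<kappa>"
          using x by (auto simp: root_space_def bracket_H_H split: if_splits)
        ultimately show ?thesis
          using root_spaces_orthogonal[OF y, of x \<kappa> h] by auto
      qed
    qed
  qed
  then show ?thesis
    using complex_vector.subspace_0[OF subspace_root_space] by blast
qed

text \<open>The bracket has weight 0, so it lies in \<open>H\<close>, where it is determined by its pairing with
  \<open>H\<close>. By invariance \<open>([x, y], h) = (x, [y, h]) = \<beta> h (x, y)\<close>.\<close>

lemma bracket_opposite_roots:
  assumes "\<beta> \<in> dual_space H" "x \<in> root_space H \<beta>" "y \<in> root_space H (\<lambda>h. - \<beta> h)"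
  shows "bracket x y = form x y *\<^sub>C nu_inv H form \<beta>"
proof -
  have zero: "(\<lambda>h. 0) \<in> dual_space H" by (simp add: dual_space_def)
  have "bracket x y \<in> root_space H (\<lambda>h. 0)"
    using bracket_root_spaces[OF assms(2,3)] by simp
  then have xy: "bracket x y \<in> H"
    using weight_vector_cases(2)[OF zero] complex_vector.subspace_0[OF subspace_H] by metis
  let ?c = "form x y"
  have scale: "(\<lambda>h. ?c * \<beta> h) \<in> dual_space H"
    using assms(1) by (auto simp: dual_space_def algebra_simps)
  have "form (bracket x y) h = ?c * \<beta> h" if h: "h \<in> H" for h
  proof -
    have "bracket y h = \<beta> h *\<^sub>C y"
      using assms(3) h by (subst bracket_antisymmetric) (simp add: root_space_def)
    then show ?thesis by (simp add: invariant form_linear_simps)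
  qed
  then have "bracket x y = nu_inv H form (\<lambda>h. ?c * \<beta> h)"
    by (rule nu_inv_unique[OF scale xy])
  also have "\<dots> = ?c *\<^sub>C nu_inv H form \<beta>"
    using assms(1) scale
    by (intro nu_inv_unique[symmetric] complex_vector.subspace_scale subspace_H nu_inv_mem)
      (auto simp: form_linear_simps form_nu_inv)
  finally show ?thesis .
qed

end

section \<open>Telescoping\<close>

text \<open>Along each string \<open>\<beta>, s \<beta>, s (s \<beta>), \<dots>\<close> the terms cancel in pairs, and an unpaired term at an
  end of the string vanishes, except for \<open>Y \<kappa>\<close>. In the application \<open>R\<close> is the set of positive
  roots and \<open>s\<close> the translation by the simple root \<open>\<kappa>\<close>. The finite set \<open>S\<close> need not be stable
  under \<open>s\<close>, so the cancelling terms are matched on the supports of \<open>X\<close> and \<open>Y\<close>.\<close>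

lemma sum_shift_cancel:
  fixes X Y :: "'r \<Rightarrow> 'b::ab_group_add"
  assumes "finite S" "S \<subseteq> R" "inj s" "\<kappa> \<in> R"
    and X0: "\<And>\<beta>. \<beta> \<in> R - S \<Longrightarrow> X \<beta> = 0" and Y0: "\<And>\<beta>. \<beta> \<in> R - S \<Longrightarrow> Y \<beta> = 0"
    and cancel: "\<And>\<beta>. \<beta> \<in> R \<Longrightarrow> s \<beta> \<in> R \<Longrightarrow> X \<beta> = - Y (s \<beta>)"
    and top: "\<And>\<beta>. \<beta> \<in> R \<Longrightarrow> s \<beta> \<notin> R \<Longrightarrow> X \<beta> = 0"
    and bottom: "\<And>\<gamma>. \<gamma> \<in> R \<Longrightarrow> \<gamma> \<noteq> \<kappa> \<Longrightarrow> \<gamma> \<notin> s ` R \<Longrightarrow> Y \<gamma> = 0"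
    and \<kappa>: "\<kappa> \<notin> s ` R"
  shows "(\<Sum>\<beta>\<in>S. X \<beta> + Y \<beta>) = Y \<kappa>"
proof -
  let ?A = "{\<beta> \<in> S. s \<beta> \<in> R \<and> Y (s \<beta>) \<noteq> 0}"
  have "(\<Sum>\<beta>\<in>S. X \<beta>) = (\<Sum>\<beta>\<in>?A. - Y (s \<beta>))"
  proof (rule sum.mono_neutral_cong_right[OF assms(1)])
    show "\<forall>\<beta>\<in>S - ?A. X \<beta> = 0"
    proof
      fix \<beta> assume "\<beta> \<in> S - ?A"
      then show "X \<beta> = 0"
        using assms(2) cancel[of \<beta>] top[of \<beta>] by (cases "s \<beta> \<in> R") auto
    qed
  qed (use assms(2) cancel in auto)
  also have "\<dots> = - (\<Sum>\<gamma>\<in>s ` ?A. Y \<gamma>)"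
    using assms(3) by (subst sum.reindex) (auto simp: sum_negf intro: inj_on_subset)
  finally have X: "(\<Sum>\<beta>\<in>S. X \<beta>) = - (\<Sum>\<gamma>\<in>s ` ?A. Y \<gamma>)" .
  have fin: "finite (s ` ?A)" using assms(1) by simp
  have "(\<Sum>\<gamma>\<in>S. Y \<gamma>) = (\<Sum>\<gamma>\<in>insert \<kappa> (s ` ?A). Y \<gamma>)"
  proof (rule sum.mono_neutral_cong[OF fin[THEN finite.insertI] assms(1)])
    fix \<gamma> assume "\<gamma> \<in> insert \<kappa> (s ` ?A) - S"
    then show "Y \<gamma> = 0" using Y0 assms(4) by auto
  next
    fix \<gamma> assume \<gamma>: "\<gamma> \<in> S - insert \<kappa> (s ` ?A)"
    show "Y \<gamma> = 0"
    proof (rule ccontr)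
      assume nz: "Y \<gamma> \<noteq> 0"
      with \<gamma> bottom assms(2) obtain \<beta> where \<beta>: "\<beta> \<in> R" "\<gamma> = s \<beta>" by blast
      with \<gamma> assms(2) nz cancel X0 have "\<beta> \<in> S" by (metis DiffD1 DiffI neg_equal_0_iff_equal subsetD)
      with \<beta> \<gamma> assms(2) nz show False by auto
    qed
  qed simp
  also have "\<dots> = Y \<kappa> + (\<Sum>\<gamma>\<in>s ` ?A. Y \<gamma>)"
    using fin \<kappa> assms(2) by (subst sum.insert) auto
  finally show ?thesis using X by (simp add: sum.distrib)
qed

section \<open>The operators of the module\<close>

context lie_module
begin

lemmas act_linear_simps = clinear_simps[OF linear_act]

end

locale tensor_module = lie_module act
  for act :: "('g::complex_lie_algebra, 'a::complex_comm_algebra) tensor \<Rightarrow> 'v::complex_vector \<Rightarrow> 'v"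
begin

lemma clinear_act_tensor: "clinear (\<lambda>x. act (x \<otimes> a) v)"
  by (rule clinearI) (simp_all add: tensor_relations clinear_simps[OF linear_act_left])

lemmas act_tensor_simps = clinear_simps[OF clinear_act_tensor]

lemma act_commute:
  "act (x \<otimes> a) (act (y \<otimes> b) v) = act (bracket x y \<otimes> (a * b)) v + act (y \<otimes> b) (act (x \<otimes> a) v)"
  using act_bracket[of "x \<otimes> a" "y \<otimes> b" v] by (simp add: bracket_tensor)

text \<open>The commutator is a derivation, applied here to a product of two operators. As the
  acting element is \<open>z \<otimes> 1\<close>, the coefficients \<open>a\<close> and \<open>b\<close> do not change.\<close>

lemma act_commute_product:
  "act (z \<otimes> 1) (act (x \<otimes> a) (act (y \<otimes> b) v)) - act (x \<otimes> a) (act (y \<otimes> b) (act (z \<otimes> 1) v)) =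
    act (x \<otimes> a) (act (bracket z y \<otimes> b) v) + act (bracket z x \<otimes> a) (act (y \<otimes> b) v)"
  by (simp add: act_commute[of z 1] act_linear_simps)

lemma commutes_closed:
  assumes "clinear T"
  shows "lie_subalgebra {x. \<forall>v. T (act (x \<otimes> 1) v) = act (x \<otimes> 1) (T v)}"
  unfolding lie_subalgebra_def complex_vector.subspace_def
proof (intro conjI ballI allI CollectI)
  fix x y v
  assume *: "x \<in> {x. \<forall>v. T (act (x \<otimes> 1) v) = act (x \<otimes> 1) (T v)}"
    "y \<in> {x. \<forall>v. T (act (x \<otimes> 1) v) = act (x \<otimes> 1) (T v)}"
  have eq: "act (bracket x y \<otimes> 1) w = act (x \<otimes> 1) (act (y \<otimes> 1) w) - act (y \<otimes> 1) (act (x \<otimes> 1) w)" for w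
    by (simp add: act_commute[of x 1 y 1])
  show "T (act (bracket x y \<otimes> 1) v) = act (bracket x y \<otimes> 1) (T v)"
    unfolding eq using * by (simp add: clinear_simps[OF assms])
qed (auto simp: act_tensor_simps clinear_simps[OF assms])

end

section \<open>The commutator with the sum over the positive roots\<close>

locale casimir_setting =
  kac_moody_form C H \<alpha> \<alpha>c E F form u u' + category_O act H \<alpha>
  for C :: "int^'i^'i" and H :: "'g::complex_lie_algebra set" and \<alpha> :: "'i \<Rightarrow> 'g \<Rightarrow> complex"
    and \<alpha>c E F :: "'i \<Rightarrow> 'g" and form :: "'g \<Rightarrow> 'g \<Rightarrow> complex" and u u' :: "nat \<Rightarrow> 'g"
    and act :: "('g, 'a::complex_comm_algebra) tensor \<Rightarrow> 'v::complex_vector \<Rightarrow> 'v" +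
  fixes ep em :: "('g \<Rightarrow> complex) \<Rightarrow> nat \<Rightarrow> 'g"
  assumes root_bases: "\<And>\<beta>. \<beta> \<in> positive_roots H \<alpha> \<Longrightarrow>
      dual_bases form {..<cdim (root_space H \<beta>)}
        (ep \<beta>) (root_space H \<beta>) (em \<beta>) (root_space H (\<lambda>h. - \<beta> h))"
begin

sublocale tensor_module act ..

abbreviation "root_mult \<beta> \<equiv> cdim (root_space H \<beta>)"
abbreviation "R \<equiv> positive_roots H \<alpha>"

definition root_support :: "'a \<Rightarrow> 'v \<Rightarrow> ('g \<Rightarrow> complex) set" where
  "root_support b v = {\<beta> \<in> R. \<exists>x\<in>root_space H \<beta>. act (x \<otimes> b) v \<noteq> 0}"

text \<open>Only finitely many positive roots have height below a given bound.\<close>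

lemma finite_root_support: "finite (root_support b v)"
proof -
  obtain N where "\<forall>\<beta>\<in>R. N \<le> height \<alpha> \<beta> \<longrightarrow> (\<forall>x\<in>root_space H \<beta>. act (x \<otimes> b) v = 0)"
    using high_roots_vanish by blast
  then have "root_support b v \<subseteq> {\<beta> \<in> R. height \<alpha> \<beta> < N}"
    by (auto simp: root_support_def not_le[symmetric])
  then show ?thesis using finite_positive_roots_below finite_subset by blast
qed

lemma root_basis_mem:
  assumes "\<beta> \<in> R" "j < root_mult \<beta>"
  shows "ep \<beta> j \<in> root_space H \<beta>" "em \<beta> j \<in> root_space H (\<lambda>h. - \<beta> h)"
  using dual_bases_mem[OF root_bases[OF assms(1)]] assms(2) by auto

lemma root_basis_expansion:
  assumes "\<beta> \<in> R"
  shows "x \<in> root_space H \<beta> \<Longrightarrow> x = (\<Sum>j<root_mult \<beta>. form x (em \<beta> j) *\<^sub>C ep \<beta> j)"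
    and "y \<in> root_space H (\<lambda>h. - \<beta> h) \<Longrightarrow> y = (\<Sum>j<root_mult \<beta>. form y (ep \<beta> j) *\<^sub>C em \<beta> j)"
  using dual_bases_finite_expansion[OF root_bases[OF assms] invariant_form_axioms]
    dual_bases_finite_expansion[OF dual_bases_swap[OF root_bases[OF assms] invariant_form_axioms]
      invariant_form_axioms] by blast+

lemma Omega_term_support:
  "{k \<in> root_index H \<alpha>. Omega_term act ep em a b v k \<noteq> 0} \<subseteq> (SIGMA \<beta>:root_support b v. {..<root_mult \<beta>})"
proof
  fix k assume k: "k \<in> {k \<in> root_index H \<alpha>. Omega_term act ep em a b v k \<noteq> 0}"
  obtain \<beta> j where \<beta>j: "k = (\<beta>, j)" by fastforce
  have "act (ep \<beta> j \<otimes> b) v \<noteq> 0"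
    using k by (auto simp: \<beta>j Omega_term_def act_linear_simps)
  then show "k \<in> (SIGMA \<beta>:root_support b v. {..<root_mult \<beta>})"
    using k root_basis_mem(1)[of \<beta> j] by (auto simp: \<beta>j root_index_def root_support_def)
qed

lemma finite_Omega_term_support: "finite {k \<in> root_index H \<alpha>. Omega_term act ep em a b v k \<noteq> 0}"
  by (rule finite_subset[OF Omega_term_support]) (simp add: finite_root_support)

definition half_summand :: "'a \<Rightarrow> 'a \<Rightarrow> 'v \<Rightarrow> ('g \<Rightarrow> complex) \<Rightarrow> 'v" where
  "half_summand a b v \<beta> = (\<Sum>j<root_mult \<beta>. act (em \<beta> j \<otimes> a) (act (ep \<beta> j \<otimes> b) v))"

abbreviation "half a b v \<equiv> Omega_half H \<alpha> act ep em a b v"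

lemma half_eq_sum:
  assumes "finite S" "root_support b v \<subseteq> S" "S \<subseteq> R"
  shows "half a b v = (\<Sum>\<beta>\<in>S. half_summand a b v \<beta>)"
proof -
  have "half a b v = (\<Sum>k\<in>(SIGMA \<beta>:S. {..<root_mult \<beta>}). Omega_term act ep em a b v k)"
    unfolding Omega_half_def supp_sum_def support_on_def
  proof (rule sum.mono_neutral_left)
    show "{k \<in> root_index H \<alpha>. Omega_term act ep em a b v k \<noteq> 0} \<subseteq> (SIGMA \<beta>:S. {..<root_mult \<beta>})"
      using Omega_term_support[of a b v] assms(2) by blast
  qed (use assms in \<open>auto simp: root_index_def\<close>)
  also have "\<dots> = (\<Sum>\<beta>\<in>S. half_summand a b v \<beta>)"
    using assms(1) by (simp add: sum.Sigma[symmetric] half_summand_def Omega_term_def)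
  finally show ?thesis .
qed

lemma half_summand_linear: "clinear (\<lambda>v. half_summand a b v \<beta>)"
  by (rule clinearI)
    (simp_all add: half_summand_def act_linear_simps sum.distrib complex_vector.scale_sum_right)

lemma clinear_half: "clinear (half a b)"
proof (rule clinearI)
  fix v w
  let ?S = "root_support b v \<union> root_support b w \<union> root_support b (v + w)"
  have "half a b x = (\<Sum>\<beta>\<in>?S. half_summand a b x \<beta>)" if "x \<in> {v, w, v + w}" for x
    using that finite_root_support
    by (intro half_eq_sum) (auto simp: root_support_def)
  then show "half a b (v + w) = half a b v + half a b w"
    by (simp add: clinear_simps[OF half_summand_linear] sum.distrib)
next
  fix c v
  let ?S = "root_support b v \<union> root_support b (c *\<^sub>C v)"
  have "half a b x = (\<Sum>\<beta>\<in>?S. half_summand a b x \<beta>)" if "x \<in> {v, c *\<^sub>C v}" for x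
    using that finite_root_support
    by (intro half_eq_sum) (auto simp: root_support_def)
  then show "half a b (c *\<^sub>C v) = c *\<^sub>C half a b v"
    by (simp add: clinear_simps[OF half_summand_linear] complex_vector.scale_sum_right)
qed

text \<open>The two parts of the commutator of \<open>z \<otimes> 1\<close> with the summand of the root \<open>\<beta>\<close>:
  \<open>z\<close> is bracketed with the vector of weight \<open>-\<beta>\<close> or with that of weight \<open>\<beta>\<close>.\<close>

definition bracket_em :: "'g \<Rightarrow> 'a \<Rightarrow> 'a \<Rightarrow> 'v \<Rightarrow> ('g \<Rightarrow> complex) \<Rightarrow> 'v" where
  "bracket_em z a b v \<beta> = (\<Sum>j<root_mult \<beta>. act (bracket z (em \<beta> j) \<otimes> a) (act (ep \<beta> j \<otimes> b) v))"

definition bracket_ep :: "'g \<Rightarrow> 'a \<Rightarrow> 'a \<Rightarrow> 'v \<Rightarrow> ('g \<Rightarrow> complex) \<Rightarrow> 'v" where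
  "bracket_ep z a b v \<beta> = (\<Sum>j<root_mult \<beta>. act (em \<beta> j \<otimes> a) (act (bracket z (ep \<beta> j) \<otimes> b) v))"

text \<open>The set \<open>S\<close> contains the roots that act non-trivially on \<open>v\<close> or on \<open>z v\<close>. Outside of it the
  bracket \<open>[z, e\<^sub>\<beta>]\<close> kills \<open>v\<close> as well, so both parts of the commutator have finite support
  and can be rearranged separately.\<close>

lemma half_commutator:
  obtains S where "finite S" "S \<subseteq> R"
    and "\<And>\<beta>. \<beta> \<in> R - S \<Longrightarrow> bracket_ep z a b v \<beta> = 0"
    and "\<And>\<beta>. \<beta> \<in> R - S \<Longrightarrow> bracket_em z a b v \<beta> = 0"
    and "act (z \<otimes> 1) (half a b v) - half a b (act (z \<otimes> 1) v) =
      (\<Sum>\<beta>\<in>S. bracket_ep z a b v \<beta> + bracket_em z a b v \<beta>)"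
proof
  let ?S = "root_support b v \<union> root_support b (act (z \<otimes> 1) v)"
  show S: "finite ?S" "?S \<subseteq> R"
    using finite_root_support by (auto simp: root_support_def)
  have kill: "act (x \<otimes> b) v = 0" "act (x \<otimes> b) (act (z \<otimes> 1) v) = 0"
    if "\<beta> \<in> R - ?S" "x \<in> root_space H \<beta>" for \<beta> x
    using that by (auto simp: root_support_def)
  show "bracket_em z a b v \<beta> = 0" if "\<beta> \<in> R - ?S" for \<beta>
    unfolding bracket_em_def
    using kill(1)[OF that] root_basis_mem(1)[of \<beta>] that by (intro sum.neutral) (auto simp: act_linear_simps)
  have br: "act (bracket z x \<otimes> b) v = 0" if "\<beta> \<in> R - ?S" "x \<in> root_space H \<beta>" for \<beta> x
    using act_commute[of z 1 x b v] kill[OF that] by (simp add: act_linear_simps)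
  show "bracket_ep z a b v \<beta> = 0" if "\<beta> \<in> R - ?S" for \<beta>
    unfolding bracket_ep_def
    using br[OF that] root_basis_mem(1)[of \<beta>] that by (intro sum.neutral) (auto simp: act_linear_simps)
  have "half a b v = (\<Sum>\<beta>\<in>?S. half_summand a b v \<beta>)"
    "half a b (act (z \<otimes> 1) v) = (\<Sum>\<beta>\<in>?S. half_summand a b (act (z \<otimes> 1) v) \<beta>)"
    using S by (auto intro!: half_eq_sum)
  then show "act (z \<otimes> 1) (half a b v) - half a b (act (z \<otimes> 1) v) =
      (\<Sum>\<beta>\<in>?S. bracket_ep z a b v \<beta> + bracket_em z a b v \<beta>)"
    by (simp add: act_linear_simps half_summand_def bracket_ep_def bracket_em_def
        act_commute_product sum.distrib[symmetric] sum_subtractf[symmetric])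
qed

text \<open>This is the invariance of the canonical element \<open>\<Sum> e\<^bsub>-\<beta>\<^esub> \<otimes> e\<^bsub>\<beta>\<^esub>\<close> of the form, in one weight:
  the coefficients of \<open>[z, e\<^bsub>\<beta>\<^esub>\<^sup>s]\<close> in the basis \<open>e\<^bsub>\<gamma>\<^esub>\<^sup>t\<close> are the negatives of those of
  \<open>[z, e\<^bsub>-\<gamma>\<^esub>\<^sup>t]\<close> in the basis \<open>e\<^bsub>-\<beta>\<^esub>\<^sup>s\<close>.\<close>

lemma bracket_cancel:
  assumes "\<beta> \<in> R" "\<gamma> \<in> R" "\<gamma> = (\<lambda>h. \<beta> h + \<delta> h)" "z \<in> root_space H \<delta>"
  shows "bracket_ep z a b v \<beta> = - bracket_em z a b v \<gamma>"
proof -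
  have up: "bracket z (ep \<beta> s) \<in> root_space H \<gamma>" if "s < root_mult \<beta>" for s
    using bracket_root_spaces[OF assms(4) root_basis_mem(1)[OF assms(1) that]]
    by (simp add: assms(3) add.commute)
  have down: "bracket z (em \<gamma> t) \<in> root_space H (\<lambda>h. - \<beta> h)" if "t < root_mult \<gamma>" for t
    using bracket_root_spaces[OF assms(4) root_basis_mem(2)[OF assms(2) that]]
    by (simp add: assms(3) algebra_simps)
  define c where "c s t = form (bracket z (ep \<beta> s)) (em \<gamma> t)" for s t
  have c': "form (bracket z (em \<gamma> t)) (ep \<beta> s) = - c s t" for s t
    unfolding c_def
    using invariant_skew[of z "em \<gamma> t" "ep \<beta> s"] symmetric[of "em \<gamma> t" "bracket z (ep \<beta> s)"]
    by simp
  have "bracket_ep z a b v \<beta> =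
      (\<Sum>s<root_mult \<beta>. \<Sum>t<root_mult \<gamma>. c s t *\<^sub>C act (em \<beta> s \<otimes> a) (act (ep \<gamma> t \<otimes> b) v))"
    unfolding bracket_ep_def
  proof (rule sum.cong[OF refl])
    fix s assume "s \<in> {..<root_mult \<beta>}"
    then have "bracket z (ep \<beta> s) = (\<Sum>t<root_mult \<gamma>. c s t *\<^sub>C ep \<gamma> t)"
      unfolding c_def by (intro root_basis_expansion(1)[OF assms(2) up]) simp
    then show "act (em \<beta> s \<otimes> a) (act (bracket z (ep \<beta> s) \<otimes> b) v) =
        (\<Sum>t<root_mult \<gamma>. c s t *\<^sub>C act (em \<beta> s \<otimes> a) (act (ep \<gamma> t \<otimes> b) v))"
      by (simp only: act_tensor_simps act_linear_simps)
  qed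
  also have "\<dots> = (\<Sum>t<root_mult \<gamma>. \<Sum>s<root_mult \<beta>. c s t *\<^sub>C act (em \<beta> s \<otimes> a) (act (ep \<gamma> t \<otimes> b) v))"
    by (rule sum.swap)
  also have "\<dots> = (\<Sum>t<root_mult \<gamma>. - act (bracket z (em \<gamma> t) \<otimes> a) (act (ep \<gamma> t \<otimes> b) v))"
  proof (rule sum.cong[OF refl])
    fix t assume "t \<in> {..<root_mult \<gamma>}"
    then have "bracket z (em \<gamma> t) = (\<Sum>s<root_mult \<beta>. (- c s t) *\<^sub>C em \<beta> s)"
      unfolding c'[symmetric] by (intro root_basis_expansion(2)[OF assms(1) down]) simp
    then have "act (bracket z (em \<gamma> t) \<otimes> a) w = (\<Sum>s<root_mult \<beta>. - (c s t *\<^sub>C act (em \<beta> s \<otimes> a) w))" for w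
      by (simp only: act_tensor_simps complex_vector.scale_minus_left)
    then show "(\<Sum>s<root_mult \<beta>. c s t *\<^sub>C act (em \<beta> s \<otimes> a) (act (ep \<gamma> t \<otimes> b) v)) =
        - act (bracket z (em \<gamma> t) \<otimes> a) (act (ep \<gamma> t \<otimes> b) v)"
      by (simp add: sum_negf)
  qed
  finally show ?thesis by (simp add: bracket_em_def sum_negf)
qed

lemma bracket_em_zero:
  assumes "\<beta> \<in> R" "z \<in> root_space H \<delta>" "root_space H (\<lambda>h. \<delta> h - \<beta> h) = {0}"
  shows "bracket_em z a b v \<beta> = 0"
  using bracket_root_spaces[OF assms(2) root_basis_mem(2)[OF assms(1)]] assms(3)
  by (simp add: bracket_em_def act_tensor_simps)

lemma bracket_ep_zero:
  assumes "\<beta> \<in> R" "z \<in> root_space H \<delta>" "root_space H (\<lambda>h. \<delta> h + \<beta> h) = {0}"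
  shows "bracket_ep z a b v \<beta> = 0"
  using bracket_root_spaces[OF assms(2) root_basis_mem(1)[OF assms(1)]] assms(3)
  by (simp add: bracket_ep_def act_tensor_simps act_linear_simps)

lemma positive_root_dual: "\<beta> \<in> R \<Longrightarrow> \<beta> \<in> dual_space H"
  by (simp add: positive_roots_def roots_def)

lemma root_space_above_trivial:
  assumes "\<beta> \<in> R" "(\<lambda>h. \<beta> h + \<alpha> i h) \<notin> R"
  shows "root_space H (\<lambda>h. \<alpha> i h + \<beta> h) = {0}" "root_space H (\<lambda>h. - \<alpha> i h - \<beta> h) = {0}"
proof -
  let ?\<gamma> = "\<lambda>h. \<beta> h + \<alpha> i h"
  have triv: "root_space H ?\<gamma> = {0}" by (rule positive_root_add_simple[OF assms])
  then show "root_space H (\<lambda>h. \<alpha> i h + \<beta> h) = {0}" by (simp add: add.commute)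
  obtain n where "\<beta> = root_comb \<alpha> n" using assms(1) by (auto simp: positive_roots_def)
  then have eq: "?\<gamma> = root_comb \<alpha> (n(i := Suc (n i)))"
    unfolding root_comb_add_simple by (simp add: add.commute)
  have "n(i := Suc (n i)) \<noteq> (\<lambda>_. 0)" by (metis fun_upd_same nat.distinct(1))
  then have "?\<gamma> \<noteq> (\<lambda>h. 0)" "?\<gamma> \<in> dual_space H"
    unfolding eq using root_comb_eq_zero_iff root_comb_in_dual_space by auto
  from root_space_neg_trivial[OF this(2,1) triv]
  have "root_space H (\<lambda>h. - ?\<gamma> h) = {0}" .
  moreover have "(\<lambda>h. - ?\<gamma> h) = (\<lambda>h. - \<alpha> i h - \<beta> h)" by (simp add: fun_eq_iff)
  ultimately show "root_space H (\<lambda>h. - \<alpha> i h - \<beta> h) = {0}" by simp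
qed

lemma root_space_below_trivial:
  assumes "\<gamma> \<in> R" "\<gamma> \<noteq> \<alpha> i" "\<gamma> \<notin> (\<lambda>\<beta> h. \<beta> h + \<alpha> i h) ` R"
  shows "root_space H (\<lambda>h. - \<alpha> i h + \<gamma> h) = {0}" "root_space H (\<lambda>h. \<alpha> i h - \<gamma> h) = {0}"
proof -
  let ?\<beta> = "\<lambda>h. \<gamma> h - \<alpha> i h"
  have "?\<beta> \<notin> R"
  proof
    assume "?\<beta> \<in> R"
    then have "(\<lambda>h. ?\<beta> h + \<alpha> i h) \<in> (\<lambda>\<beta> h. \<beta> h + \<alpha> i h) ` R" by (rule imageI)
    with assms(3) show False by simp
  qed
  then have triv: "root_space H ?\<beta> = {0}"
    by (rule positive_root_diff_simple[OF assms(1,2)])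
  then show "root_space H (\<lambda>h. - \<alpha> i h + \<gamma> h) = {0}" by simp
  have "?\<beta> \<noteq> (\<lambda>h. 0)" using assms(2) by (auto simp: fun_eq_iff)
  moreover have "?\<beta> \<in> dual_space H"
    using positive_root_dual[OF assms(1)] simple_root[of i] by (auto simp: dual_space_def algebra_simps)
  ultimately have "root_space H (\<lambda>h. - ?\<beta> h) = {0}"
    using triv by (intro root_space_neg_trivial)
  then show "root_space H (\<lambda>h. \<alpha> i h - \<gamma> h) = {0}" by simp
qed

lemma simple_root_not_sum: "\<alpha> i \<notin> (\<lambda>\<beta> h. \<beta> h + \<alpha> i h) ` R"
  by (auto simp: positive_roots_def roots_def fun_eq_iff)

lemma inj_add_simple_root: "inj (\<lambda>\<beta> h. \<beta> h + \<alpha> i h)"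
  by (rule injI) (simp add: fun_eq_iff)

abbreviation "t i \<equiv> nu_inv H form (\<alpha> i)"

text \<open>The sum telescopes with \<open>X\<close> the brackets with \<open>e\<^sub>\<beta>\<close> and \<open>Y\<close> those with \<open>e\<^bsub>-\<beta>\<^esub>\<close>. The
  remaining term at \<open>\<alpha> i\<close> is evaluated without a choice of \<open>E i\<close> as basis vector: the
  coefficients \<open>(E i, e\<^bsub>-\<alpha> i\<^esub>\<^sup>j)\<close> are those of \<open>E i\<close> in the basis \<open>e\<^bsub>\<alpha> i\<^esub>\<^sup>j\<close>.\<close>

lemma half_commutator_E:
  "act (E i \<otimes> 1) (half a b v) - half a b (act (E i \<otimes> 1) v) = act (t i \<otimes> a) (act (E i \<otimes> b) v)"
proof -
  obtain S where S: "finite S" "S \<subseteq> R"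
    and zero: "\<And>\<beta>. \<beta> \<in> R - S \<Longrightarrow> bracket_ep (E i) a b v \<beta> = 0"
      "\<And>\<beta>. \<beta> \<in> R - S \<Longrightarrow> bracket_em (E i) a b v \<beta> = 0"
    and eq: "act (E i \<otimes> 1) (half a b v) - half a b (act (E i \<otimes> 1) v) =
      (\<Sum>\<beta>\<in>S. bracket_ep (E i) a b v \<beta> + bracket_em (E i) a b v \<beta>)"
    using half_commutator[of "E i" a b v] by blast
  have "(\<Sum>\<beta>\<in>S. bracket_ep (E i) a b v \<beta> + bracket_em (E i) a b v \<beta>) =
      bracket_em (E i) a b v (\<alpha> i)"
  proof (rule sum_shift_cancel[OF S inj_add_simple_root[of i] simple_root_in_positive_roots zero])
    show "bracket_ep (E i) a b v \<beta> = - bracket_em (E i) a b v (\<lambda>h. \<beta> h + \<alpha> i h)"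
      if "\<beta> \<in> R" "(\<lambda>h. \<beta> h + \<alpha> i h) \<in> R" for \<beta>
      by (rule bracket_cancel[OF that refl E_in_root_space])
    show "bracket_ep (E i) a b v \<beta> = 0" if "\<beta> \<in> R" "(\<lambda>h. \<beta> h + \<alpha> i h) \<notin> R" for \<beta>
      by (rule bracket_ep_zero[OF that(1) E_in_root_space root_space_above_trivial(1)[OF that]])
    show "bracket_em (E i) a b v \<gamma> = 0"
      if "\<gamma> \<in> R" "\<gamma> \<noteq> \<alpha> i" "\<gamma> \<notin> (\<lambda>\<beta> h. \<beta> h + \<alpha> i h) ` R" for \<gamma>
      by (rule bracket_em_zero[OF that(1) E_in_root_space root_space_below_trivial(2)[OF that]])
  qed (assumption | rule simple_root_not_sum)+
  also have "\<dots> = (\<Sum>j<root_mult (\<alpha> i). form (E i) (em (\<alpha> i) j) *\<^sub>C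
      act (t i \<otimes> a) (act (ep (\<alpha> i) j \<otimes> b) v))"
    unfolding bracket_em_def
    using bracket_opposite_roots[OF simple_root E_in_root_space]
      root_basis_mem(2)[OF simple_root_in_positive_roots]
    by (intro sum.cong) (auto simp: act_tensor_simps)
  also have "\<dots> = act (t i \<otimes> a)
      (act ((\<Sum>j<root_mult (\<alpha> i). form (E i) (em (\<alpha> i) j) *\<^sub>C ep (\<alpha> i) j) \<otimes> b) v)"
    by (simp add: act_tensor_simps act_linear_simps)
  also have "(\<Sum>j<root_mult (\<alpha> i). form (E i) (em (\<alpha> i) j) *\<^sub>C ep (\<alpha> i) j) = E i"
    by (rule root_basis_expansion(1)[OF simple_root_in_positive_roots E_in_root_space, symmetric])
  finally show ?thesis using eq by simp
qed

text \<open>Now \<open>z\<close> lowers weights, and the two parts of the commutator exchange their roles: the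
  bracket with \<open>e\<^bsub>-\<beta>\<^esub>\<close> cancels the bracket with \<open>e\<^bsub>\<beta> + \<alpha> i\<^esub>\<close>.\<close>

lemma half_commutator_F:
  "act (F i \<otimes> 1) (half a b v) - half a b (act (F i \<otimes> 1) v) = - act (F i \<otimes> a) (act (t i \<otimes> b) v)"
proof -
  obtain S where S: "finite S" "S \<subseteq> R"
    and zero: "\<And>\<beta>. \<beta> \<in> R - S \<Longrightarrow> bracket_ep (F i) a b v \<beta> = 0"
      "\<And>\<beta>. \<beta> \<in> R - S \<Longrightarrow> bracket_em (F i) a b v \<beta> = 0"
    and eq: "act (F i \<otimes> 1) (half a b v) - half a b (act (F i \<otimes> 1) v) =
      (\<Sum>\<beta>\<in>S. bracket_ep (F i) a b v \<beta> + bracket_em (F i) a b v \<beta>)"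
    using half_commutator[of "F i" a b v] by blast
  have "(\<Sum>\<beta>\<in>S. bracket_em (F i) a b v \<beta> + bracket_ep (F i) a b v \<beta>) =
      bracket_ep (F i) a b v (\<alpha> i)"
  proof (rule sum_shift_cancel[OF S inj_add_simple_root[of i] simple_root_in_positive_roots zero(2,1)])
    show "bracket_em (F i) a b v \<beta> = - bracket_ep (F i) a b v (\<lambda>h. \<beta> h + \<alpha> i h)"
      if "\<beta> \<in> R" "(\<lambda>h. \<beta> h + \<alpha> i h) \<in> R" for \<beta>
      using bracket_cancel[OF that(2,1) _ F_in_root_space] by simp
    show "bracket_em (F i) a b v \<beta> = 0" if "\<beta> \<in> R" "(\<lambda>h. \<beta> h + \<alpha> i h) \<notin> R" for \<beta>
      by (rule bracket_em_zero[OF that(1) F_in_root_space root_space_above_trivial(2)[OF that]])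
    show "bracket_ep (F i) a b v \<gamma> = 0"
      if "\<gamma> \<in> R" "\<gamma> \<noteq> \<alpha> i" "\<gamma> \<notin> (\<lambda>\<beta> h. \<beta> h + \<alpha> i h) ` R" for \<gamma>
      by (rule bracket_ep_zero[OF that(1) F_in_root_space root_space_below_trivial(1)[OF that]])
  qed (assumption | rule simple_root_not_sum)+
  also have "\<dots> = (\<Sum>j<root_mult (\<alpha> i). - (form (F i) (ep (\<alpha> i) j) *\<^sub>C
      act (em (\<alpha> i) j \<otimes> a) (act (t i \<otimes> b) v)))"
    unfolding bracket_ep_def
  proof (rule sum.cong[OF refl])
    fix j assume "j \<in> {..<root_mult (\<alpha> i)}"
    then have "bracket (F i) (ep (\<alpha> i) j) = - (form (ep (\<alpha> i) j) (F i) *\<^sub>C t i)"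
      using bracket_opposite_roots[OF simple_root _ F_in_root_space]
        root_basis_mem(1)[OF simple_root_in_positive_roots]
      by (subst bracket_antisymmetric) auto
    then show "act (em (\<alpha> i) j \<otimes> a) (act (bracket (F i) (ep (\<alpha> i) j) \<otimes> b) v) =
        - (form (F i) (ep (\<alpha> i) j) *\<^sub>C act (em (\<alpha> i) j \<otimes> a) (act (t i \<otimes> b) v))"
      by (simp add: act_tensor_simps act_linear_simps symmetric)
  qed
  also have "\<dots> = - act ((\<Sum>j<root_mult (\<alpha> i). form (F i) (ep (\<alpha> i) j) *\<^sub>C em (\<alpha> i) j) \<otimes> a)
      (act (t i \<otimes> b) v)"
    by (simp add: act_tensor_simps sum_negf)
  also have "(\<Sum>j<root_mult (\<alpha> i). form (F i) (ep (\<alpha> i) j) *\<^sub>C em (\<alpha> i) j) = F i"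
    by (rule root_basis_expansion(2)[OF simple_root_in_positive_roots F_in_root_space, symmetric])
  finally show ?thesis using eq by (simp add: add.commute)
qed

lemma half_commutator_H:
  assumes "h \<in> H"
  shows "act (h \<otimes> 1) (half a b v) = half a b (act (h \<otimes> 1) v)"
proof -
  have "bracket_ep h a b v \<beta> + bracket_em h a b v \<beta> = 0" if "\<beta> \<in> R" for \<beta>
    using root_basis_mem[OF that] assms
    by (simp add: bracket_ep_def bracket_em_def root_space_def act_tensor_simps act_linear_simps
        sum_negf)
  then show ?thesis
    using half_commutator[of h a b v] by (metis (no_types, lifting) eq_iff_diff_eq_0 subsetD sum.neutral)
qed

definition cartan_part :: "'a \<Rightarrow> 'a \<Rightarrow> 'v \<Rightarrow> 'v" where
  "cartan_part a b v = (\<Sum>i<cdim H. act (u' i \<otimes> a) (act (u i \<otimes> b) v))"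

lemma clinear_cartan_part: "clinear (cartan_part a b)"
  by (rule clinearI)
    (simp_all add: cartan_part_def act_linear_simps sum.distrib complex_vector.scale_sum_right)

text \<open>Bracketing \<open>z\<close> with a basis vector of \<open>H\<close> gives a multiple of \<open>z\<close>. The factors are, up to
  sign, the values of \<open>\<delta>\<close> on the basis, and these are the coefficients of
  \<^term>\<open>nu_inv H form \<delta>\<close> in the dual basis.\<close>

lemma cartan_part_commutator:
  assumes "\<delta> \<in> dual_space H" "z \<in> root_space H \<delta>"
  shows "act (z \<otimes> 1) (cartan_part a b v) - cartan_part a b (act (z \<otimes> 1) v) =
    - act (z \<otimes> a) (act (nu_inv H form \<delta> \<otimes> b) v) - act (nu_inv H form \<delta> \<otimes> a) (act (z \<otimes> b) v)"
proof -
  have br: "bracket z h = - (\<delta> h *\<^sub>C z)" if "h \<in> H" for h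
    using assms(2) that by (subst bracket_antisymmetric) (simp add: root_space_def)
  have "act (z \<otimes> 1) (cartan_part a b v) - cartan_part a b (act (z \<otimes> 1) v) =
      (\<Sum>k<cdim H. act (u' k \<otimes> a) (act (bracket z (u k) \<otimes> b) v) +
        act (bracket z (u' k) \<otimes> a) (act (u k \<otimes> b) v))"
    by (simp only: cartan_part_def act_linear_simps sum_subtractf[symmetric] act_commute_product)
  also have "\<dots> = (\<Sum>k<cdim H. - (\<delta> (u k) *\<^sub>C act (u' k \<otimes> a) (act (z \<otimes> b) v)) -
      \<delta> (u' k) *\<^sub>C act (z \<otimes> a) (act (u k \<otimes> b) v))"
    using cartan_basis_mem by (intro sum.cong) (auto simp: br act_tensor_simps act_linear_simps)
  also have "\<dots> = - act ((\<Sum>k<cdim H. \<delta> (u k) *\<^sub>C u' k) \<otimes> a) (act (z \<otimes> b) v) -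
      act (z \<otimes> a) (act ((\<Sum>k<cdim H. \<delta> (u' k) *\<^sub>C u k) \<otimes> b) v)"
    by (simp add: act_tensor_simps act_linear_simps sum_subtractf sum_negf)
  finally show ?thesis
    by (simp add: nu_inv_expansion[OF assms(1)] algebra_simps)
qed

end

section \<open>Centrality\<close>

theorem theorem2p5:
  fixes C :: "int^'i^'i"
    and H :: "'g::complex_lie_algebra set"
    and \<alpha> :: "'i \<Rightarrow> 'g \<Rightarrow> complex"
    and \<alpha>c E F :: "'i \<Rightarrow> 'g"
    and form :: "'g \<Rightarrow> 'g \<Rightarrow> complex"
    and \<rho> :: "'g \<Rightarrow> complex"
    and u u' :: "nat \<Rightarrow> 'g"
    and ep em :: "('g \<Rightarrow> complex) \<Rightarrow> nat \<Rightarrow> 'g"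
    and act :: "('g, 'a::complex_comm_algebra) tensor \<Rightarrow> 'v::complex_vector \<Rightarrow> 'v"
    and a b :: 'a
  assumes kac_moody: "kac_moody_algebra C H \<alpha> \<alpha>c E F"
    and symmetrizable: "symmetrizable C"
    and form: "invariant_form form"
    and \<rho>: "\<rho> \<in> dual_space H"
      "\<And>i. dual_form H form \<rho> (\<alpha> i) = 1 / 2 * dual_form H form (\<alpha> i) (\<alpha> i)"
    and root_bases: "\<And>\<beta>. \<beta> \<in> positive_roots H \<alpha> \<Longrightarrow>
      dual_bases form {..<cdim (root_space H \<beta>)}
        (ep \<beta>) (root_space H \<beta>) (em \<beta>) (root_space H (\<lambda>h. - \<beta> h))"
    and cartan_bases: "dual_bases form {..<cdim H} u H u' H"
    and module: "category_O act H \<alpha>"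
  shows "(\<forall>v. finite {k \<in> root_index H \<alpha>. Omega_term act ep em a b v k \<noteq> 0} \<and>
              finite {k \<in> root_index H \<alpha>. Omega_term act ep em b a v k \<noteq> 0}) \<and>
         clinear (Omega H \<alpha> form \<rho> u u' ep em act a b) \<and>
         (\<forall>x v. Omega H \<alpha> form \<rho> u u' ep em act a b (act (x \<otimes> 1) v) =
                act (x \<otimes> 1) (Omega H \<alpha> form \<rho> u u' ep em act a b v))"
proof -
  interpret casimir_setting C H \<alpha> \<alpha>c E F form u u' act ep em
    using kac_moody form module cartan_bases root_bases
    by (simp add: casimir_setting_def casimir_setting_axioms_def kac_moody_form_def
        kac_moody_form_axioms_def)
  let ?\<Omega> = "Omega H \<alpha> form \<rho> u u' ep em act a b"
  let ?t\<rho> = "nu_inv H form \<rho>"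
  have \<Omega>: "?\<Omega> v = act ((2 *\<^sub>C ?t\<rho>) \<otimes> (a * b)) v + cartan_part a b v + half a b v + half b a v"
    for v
    by (simp add: Omega_def cartan_part_def)
  have t\<rho>: "?t\<rho> \<in> H" by (rule nu_inv_mem[OF \<rho>(1)])
  \<comment> \<open>The defining property of \<open>\<rho>\<close>, read as \<open>(\<alpha>\<^sub>i, \<alpha>\<^sub>i) = 2 (\<rho>, \<alpha>\<^sub>i)\<close>.\<close>
  have \<alpha>\<rho>: "\<alpha> i (t i) = 2 * \<alpha> i ?t\<rho>" for i
    using \<rho>(2)[of i] form_nu_inv[OF simple_root[of i]] nu_inv_mem[OF simple_root[of i]] t\<rho>
    by (simp add: dual_form_def symmetric[of ?t\<rho>] field_simps)
  have "?\<Omega> = (\<lambda>v. act ((2 *\<^sub>C ?t\<rho>) \<otimes> (a * b)) v + cartan_part a b v + half a b v + half b a v)"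
    using \<Omega> by blast
  then have linear: "clinear ?\<Omega>"
    by (simp only:) (intro clinear_add linear_act clinear_cartan_part clinear_half)
  \<comment> \<open>For a weight vector \<open>z\<close> everything except the infinite sums is explicit. With \<open>\<delta>\<close> equal to
    \<open>\<alpha>\<^sub>i\<close>, \<open>-\<alpha>\<^sub>i\<close> and 0 this serves all three kinds of generators.\<close>
  have commutator: "act (z \<otimes> 1) (?\<Omega> v) - ?\<Omega> (act (z \<otimes> 1) v) =
      - (2 * \<delta> ?t\<rho>) *\<^sub>C act (z \<otimes> (a * b)) v
      + (- act (z \<otimes> a) (act (nu_inv H form \<delta> \<otimes> b) v)
         - act (nu_inv H form \<delta> \<otimes> a) (act (z \<otimes> b) v))
      + (act (z \<otimes> 1) (half a b v) - half a b (act (z \<otimes> 1) v))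
      + (act (z \<otimes> 1) (half b a v) - half b a (act (z \<otimes> 1) v))"
    if "\<delta> \<in> dual_space H" "z \<in> root_space H \<delta>" for \<delta> z v
  proof -
    have "bracket z (2 *\<^sub>C ?t\<rho>) = - (2 * \<delta> ?t\<rho>) *\<^sub>C z"
      using that(2) t\<rho>
      by (subst bracket_antisymmetric) (simp add: root_space_def bracket_scaleC_left scaleC_scaleC)
    then have \<rho>_part: "act (z \<otimes> 1) (act ((2 *\<^sub>C ?t\<rho>) \<otimes> (a * b)) v) -
        act ((2 *\<^sub>C ?t\<rho>) \<otimes> (a * b)) (act (z \<otimes> 1) v) = - (2 * \<delta> ?t\<rho>) *\<^sub>C act (z \<otimes> (a * b)) v"
      using act_commute[of z 1 "2 *\<^sub>C ?t\<rho>" "a * b" v]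
      by (simp only: act_tensor_simps(2) mult_1_left add_diff_cancel_right')
    show ?thesis
      by (simp only: \<Omega> act_linear_simps(1) add_diff_add \<rho>_part cartan_part_commutator[OF that])
  qed
  have E: "?\<Omega> (act (E i \<otimes> 1) v) = act (E i \<otimes> 1) (?\<Omega> v)" for i v
  proof -
    have "bracket (t i) (E i) = \<alpha> i (t i) *\<^sub>C E i"
      using nu_inv_mem[OF simple_root] by (rule bracket_H_E)
    then have "act (t i \<otimes> b) (act (E i \<otimes> a) v) =
        (2 * \<alpha> i ?t\<rho>) *\<^sub>C act (E i \<otimes> (a * b)) v + act (E i \<otimes> a) (act (t i \<otimes> b) v)"
      by (simp add: act_commute[of "t i" b] act_tensor_simps \<alpha>\<rho> mult.commute)
    then show ?thesis
      using commutator[OF simple_root E_in_root_space, of i v]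
      unfolding half_commutator_E by simp
  qed
  have F: "?\<Omega> (act (F i \<otimes> 1) v) = act (F i \<otimes> 1) (?\<Omega> v)" for i v
  proof -
    have "bracket (t i) (F i) = - (\<alpha> i (t i) *\<^sub>C F i)"
      using nu_inv_mem[OF simple_root] by (rule bracket_H_F)
    then have "act (t i \<otimes> a) (act (F i \<otimes> b) v) =
        - ((2 * \<alpha> i ?t\<rho>) *\<^sub>C act (F i \<otimes> (a * b)) v) + act (F i \<otimes> b) (act (t i \<otimes> a) v)"
      by (simp add: act_commute[of "t i" a] act_tensor_simps \<alpha>\<rho>)
    then show ?thesis
      using commutator[OF neg_dual_space[OF simple_root] F_in_root_space, of i v]
      unfolding half_commutator_F nu_inv_neg[OF simple_root]
      by (simp add: act_tensor_simps act_linear_simps)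
  qed
  have H: "?\<Omega> (act (h \<otimes> 1) v) = act (h \<otimes> 1) (?\<Omega> v)" if "h \<in> H" for h v
  proof -
    have zero: "(\<lambda>h. 0) \<in> dual_space H" by (simp add: dual_space_def)
    have "nu_inv H form (\<lambda>h. 0) = 0"
      using complex_vector.subspace_0[OF subspace_H]
      by (intro nu_inv_unique[OF zero, symmetric]) (auto simp: form_linear_simps)
    moreover have "h \<in> root_space H (\<lambda>h. 0)"
      using that by (simp add: root_space_def bracket_H_H)
    ultimately show ?thesis
      using commutator[OF zero, of h v]
      by (simp add: half_commutator_H[OF that] act_tensor_simps act_linear_simps)
  qed
  have "{x. \<forall>v. ?\<Omega> (act (x \<otimes> 1) v) = act (x \<otimes> 1) (?\<Omega> v)} = UNIV"
    by (rule generated[OF commutes_closed[OF linear]]) (use E F H in auto)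
  then show ?thesis
    using finite_Omega_term_support linear by auto
qed

end
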